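(* Let $\Pi=(P,\mathcal{L})$ and $\Pi'=(P',\mathcal{L}')$ be $n$-dimensional projective spaces and let $k$ be an integer with $0<k<n-1$. Let $f$ be a mapping of $\mathcal{G}_{k}(\Pi)$ to $\mathcal{G}_{k}(\Pi')$ which sends every base subset of $\mathcal{G}_{k}(\Pi)$ to a base subset of $\mathcal{G}_{k}(\Pi')$. Then: (1) if $n\ne 2k+1$, there is a strong embedding $g$ of $\Pi$ to $\Pi'$ with $f=G_{k}(g)$; (2) if $n=2k+1$, there is a strong embedding $g$ of $\Pi$ to $\Pi'$ or of $\Pi$ to the dual space $\Pi'^{*}$ with $f=G_{k}(g)$ (in the dual case, $G_k(g)$ is regarded as a map to $\mathcal{G}_k(\Pi')$ via the identification $\mathcal{G}_{k}(\Pi'^{*})=\mathcal{G}_{n-k-1}(\Pi')=\mathcal{G}_k(\Pi')$).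
   Context: A linear space $\Pi=(P,\mathcal{L})$ is a set $P$ of points with a family $\mathcal{L}$ of proper subsets (lines) such that each line has at least two points and any two distinct points $p,q$ lie on exactly one line $pq$. Points are collinear if some line contains them. A subspace is a set $S\subset P$ with $pq\subset S$ for all distinct $p,q\in S$; $\overline{X}$ denotes the smallest subspace containing $X$. A set $X$ is independent if $\overline{X}$ is not spanned by a proper subset of $X$; a base of a subspace $S$ is an independent set spanning $S$. A subspace is $m$-dimensional if $m+1$ is the smallest number of points spanning it (the empty set is $(-1)$-dimensional). A projective space is a linear space in which every $2$-dimensional subspace is a projective plane: any two of its lines meet and every line has at least three points. $\mathcal{G}_k(\Pi)$ is the set of $k$-dimensional subspaces. If $B$ is a base of $\Pi$, the base subset of $\mathcal{G}_k(\Pi)$ associated with $B$ is the set of all $k$-dimensional subspaces spanned by points of $B$. A strong embedding of $\Pi$ to $\Pi'$ is an injection $g:P\to P'$ sending collinear triples to collinear triples, non-collinear triples to non-collinear triples, and independent sets to independent sets; then $\dim\overline{g(S)}=\dim S$ for every subspace $S$, and $G_k(g):\mathcal{G}_k(\Pi)\to\mathcal{G}_k(\Pi')$ is $S\mapsto\overline{g(S)}$. The dual $\Pi'^{*}$ of an $n$-dimensional projective space $\Pi'$ has as points the $(n-1)$-dimensional subspaces of $\Pi'$, and as lines the sets of all $(n-1)$-dimensional subspaces containing a fixed $(n-2)$-dimensional subspace; it is an $n$-dimensional projective space whose $k$-dimensional subspaces are the sets of all $(n-1)$-dimensional subspaces of $\Pi'$ containing a fixed $(n-k-1)$-dimensional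 subspace, and $\mathcal{G}_k(\Pi'^{*})$ is identified with $\mathcal{G}_{n-k-1}(\Pi')$ in this way. *)

theory Defs
  imports Main
begin

definition linear_space :: "'a set \<Rightarrow> 'a set set \<Rightarrow> bool" where
  "linear_space P L \<longleftrightarrow>
     (\<forall>l\<in>L. l \<subset> P \<and> (\<exists>p q. p \<noteq> q \<and> p \<in> l \<and> q \<in> l)) \<and>
     (\<forall>p\<in>P. \<forall>q\<in>P. p \<noteq> q \<longrightarrow> (\<exists>!l. l \<in> L \<and> p \<in> l \<and> q \<in> l))"

definition collinear :: "'a set set \<Rightarrow> 'a set \<Rightarrow> bool" where
  "collinear L X \<longleftrightarrow> (\<exists>l\<in>L. X \<subseteq> l)"

definition subspace :: "'a set \<Rightarrow> 'a set set \<Rightarrow> 'a set \<Rightarrow> bool" where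
  "subspace P L S \<longleftrightarrow> S \<subseteq> P \<and>
     (\<forall>l\<in>L. \<forall>p q. p \<in> S \<longrightarrow> q \<in> S \<longrightarrow> p \<noteq> q \<longrightarrow> p \<in> l \<longrightarrow> q \<in> l \<longrightarrow> l \<subseteq> S)"

definition span :: "'a set \<Rightarrow> 'a set set \<Rightarrow> 'a set \<Rightarrow> 'a set" where
  "span P L X = \<Inter>{S. subspace P L S \<and> X \<subseteq> S}"

definition independent :: "'a set \<Rightarrow> 'a set set \<Rightarrow> 'a set \<Rightarrow> bool" where
  "independent P L X \<longleftrightarrow> X \<subseteq> P \<and> (\<forall>Y. Y \<subset> X \<longrightarrow> span P L Y \<noteq> span P L X)"

definition is_base :: "'a set \<Rightarrow> 'a set set \<Rightarrow> 'a set \<Rightarrow> bool" where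
  "is_base P L B \<longleftrightarrow> independent P L B \<and> span P L B = P"

definition has_dim :: "'a set \<Rightarrow> 'a set set \<Rightarrow> 'a set \<Rightarrow> nat \<Rightarrow> bool" where
  "has_dim P L S m \<longleftrightarrow> subspace P L S \<and>
     (\<exists>X. X \<subseteq> P \<and> finite X \<and> card X = Suc m \<and> span P L X = S) \<and>
     (\<forall>X. X \<subseteq> P \<longrightarrow> finite X \<longrightarrow> span P L X = S \<longrightarrow> Suc m \<le> card X)"

definition Gr :: "'a set \<Rightarrow> 'a set set \<Rightarrow> nat \<Rightarrow> 'a set set" where
  "Gr P L k = {S. has_dim P L S k}"

definition projective_space :: "'a set \<Rightarrow> 'a set set \<Rightarrow> bool" where
  "projective_space P L \<longleftrightarrow> linear_space P L \<and>
     (\<forall>S. has_dim P L S 2 \<longrightarrow>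
        (\<forall>l\<in>L. \<forall>m\<in>L. l \<subseteq> S \<longrightarrow> m \<subseteq> S \<longrightarrow> l \<inter> m \<noteq> {}) \<and>
        (\<forall>l\<in>L. l \<subseteq> S \<longrightarrow> (\<exists>a b c. a \<in> l \<and> b \<in> l \<and> c \<in> l \<and> a \<noteq> b \<and> a \<noteq> c \<and> b \<noteq> c)))"

definition proj_space_dim :: "'a set \<Rightarrow> 'a set set \<Rightarrow> nat \<Rightarrow> bool" where
  "proj_space_dim P L n \<longleftrightarrow> projective_space P L \<and> has_dim P L P n"

definition base_subset_of :: "'a set \<Rightarrow> 'a set set \<Rightarrow> nat \<Rightarrow> 'a set \<Rightarrow> 'a set set" where
  "base_subset_of P L k B = {S \<in> Gr P L k. \<exists>X. X \<subseteq> B \<and> span P L X = S}"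

definition is_base_subset :: "'a set \<Rightarrow> 'a set set \<Rightarrow> nat \<Rightarrow> 'a set set \<Rightarrow> bool" where
  "is_base_subset P L k \<B> \<longleftrightarrow> (\<exists>B. is_base P L B \<and> \<B> = base_subset_of P L k B)"

definition strong_embedding ::
  "'a set \<Rightarrow> 'a set set \<Rightarrow> 'b set \<Rightarrow> 'b set set \<Rightarrow> ('a \<Rightarrow> 'b) \<Rightarrow> bool" where
  "strong_embedding P L P' L' g \<longleftrightarrow> inj_on g P \<and> g ` P \<subseteq> P' \<and>
     (\<forall>x\<in>P. \<forall>y\<in>P. \<forall>z\<in>P. collinear L {x, y, z} \<longrightarrow> collinear L' {g x, g y, g z}) \<and>
     (\<forall>x\<in>P. \<forall>y\<in>P. \<forall>z\<in>P. \<not> collinear L {x, y, z} \<longrightarrow> \<not> collinear L' {g x, g y, g z}) \<and>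
     (\<forall>X. X \<subseteq> P \<longrightarrow> independent P L X \<longrightarrow> independent P' L' (g ` X))"

definition dual_points :: "'a set \<Rightarrow> 'a set set \<Rightarrow> nat \<Rightarrow> 'a set set" where
  "dual_points P L n = Gr P L (n - 1)"

definition dual_lines :: "'a set \<Rightarrow> 'a set set \<Rightarrow> nat \<Rightarrow> 'a set set set" where
  "dual_lines P L n = {{H \<in> Gr P L (n - 1). T \<subseteq> H} | T. T \<in> Gr P L (n - 2)}"

end

theory Submission
  imports Defs
begin

text \<open>
  Fix a base \<open>B\<close> of \<open>\<Pi>\<close> and write \<open>f\<close> on its base subset as a bijection \<open>\<sigma>\<close> between the
  \<open>(k+1)\<close>-subsets of \<open>B\<close> and of some base \<open>B'\<close> of \<open>\<Pi>'\<close>. Maximal intersections of two distinct base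
  subsets are complements of the sets \<open>C i j = {X. i \<in> X \<and> j \<notin> X}\<close>, so \<open>\<sigma>\<close> permutes the sets \<open>C i j\<close>.
  Since \<open>C i j\<close> and \<open>C k l\<close> are disjoint exactly if \<open>i = l\<close> or \<open>j = k\<close>, this permutation of ordered
  pairs comes from a bijection \<open>\<tau> : B \<rightarrow> B'\<close>, possibly after reversing all pairs. Hence
  \<open>\<sigma> X = \<tau> X\<close> for all \<open>X\<close>, or \<open>\<sigma> X = B' - \<tau> X\<close> for all \<open>X\<close>, the latter only if \<open>n = 2k + 1\<close>.
  Any two bases are connected by exchanging one point at a time, and two bases that differ in one
  point share enough \<open>(k+1)\<close>-subsets to see that the alternative does not depend on \<open>B\<close> and that
  \<open>\<tau> p\<close> does not depend on the base containing \<open>p\<close>. In the first case \<open>p \<mapsto> \<tau> p\<close> is the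
  embedding; in the second case, composing \<open>f\<close> with \<open>S \<mapsto> {H. S \<subseteq> H}\<close> gives a map into the dual
  space to which the first case applies.
\<close>

section \<open>Closure in linear spaces\<close>

lemma subset_span: "X \<subseteq> span P L X"
  unfolding span_def by blast

lemma span_least: "subspace P L S \<Longrightarrow> X \<subseteq> S \<Longrightarrow> span P L X \<subseteq> S"
  unfolding span_def by blast

lemma span_mono: "X \<subseteq> Y \<Longrightarrow> span P L X \<subseteq> span P L Y"
  unfolding span_def by blast

lemma span_subset_span: "Y \<subseteq> span P L X \<Longrightarrow> span P L Y \<subseteq> span P L X"
  unfolding span_def by blast

lemma span_superset: "x \<in> X \<Longrightarrow> x \<in> span P L X"
  using subset_span by (rule subsetD)

lemma span_trans: "Y \<subseteq> span P L X \<Longrightarrow> z \<in> span P L Y \<Longrightarrow> z \<in> span P L X"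
  using span_subset_span by (rule subsetD)

lemma span_absorb: "Y \<subseteq> span P L X \<Longrightarrow> X \<subseteq> Y \<Longrightarrow> span P L Y = span P L X"
  by (simp add: span_mono span_subset_span subset_antisym)

locale lspace =
  fixes P :: "'a set" and L :: "'a set set"
  assumes linear: "linear_space P L"
begin

abbreviation "cl \<equiv> span P L"

lemma line_subset: "l \<in> L \<Longrightarrow> l \<subset> P"
  using linear unfolding linear_space_def by blast

lemma line_exists: "p \<in> P \<Longrightarrow> q \<in> P \<Longrightarrow> p \<noteq> q \<Longrightarrow> \<exists>l\<in>L. p \<in> l \<and> q \<in> l"
  using linear unfolding linear_space_def by metis

lemma line_unique:
  assumes "l \<in> L" "l' \<in> L" "p \<in> l" "q \<in> l" "p \<in> l'" "q \<in> l'" "p \<noteq> q"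
  shows "l = l'"
proof -
  have "p \<in> P" "q \<in> P" using assms line_subset by blast+
  then have "\<exists>!l. l \<in> L \<and> p \<in> l \<and> q \<in> l"
    using linear assms(7) unfolding linear_space_def by simp
  then show ?thesis using assms by blast
qed

lemma subspace_carrier: "subspace P L P"
  using line_subset unfolding subspace_def by blast

lemma span_closed: "X \<subseteq> P \<Longrightarrow> cl X \<subseteq> P"
  using span_least subspace_carrier by blast

lemma subspace_line:
  "\<lbrakk>subspace P L S; l \<in> L; x \<in> S; y \<in> S; x \<noteq> y; x \<in> l; y \<in> l\<rbrakk> \<Longrightarrow> l \<subseteq> S"
  unfolding subspace_def by simp

lemma subspace_span:
  assumes "X \<subseteq> P"
  shows "subspace P L (cl X)"
proof -
  have "l \<subseteq> cl X" if l: "l \<in> L" "p \<in> cl X" "q \<in> cl X" "p \<noteq> q" "p \<in> l" "q \<in> l" for l p q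
  proof -
    have "l \<subseteq> S" if S: "subspace P L S" "X \<subseteq> S" for S
      using subspace_line[OF S(1) l(1) _ _ l(4-6)] span_least[OF S] l(2,3) by blast
    then show ?thesis unfolding span_def by blast
  qed
  then show ?thesis using span_closed[OF assms] unfolding subspace_def by simp
qed

lemma span_subspace: "subspace P L S \<Longrightarrow> cl S = S"
  by (simp add: span_least subset_antisym subset_span)

lemma span_carrier: "cl P = P"
  by (simp add: span_subspace subspace_carrier)

lemma span_empty: "cl {} = {}"
  by (simp add: span_subspace subspace_def)

lemma span_singleton: "x \<in> P \<Longrightarrow> cl {x} = {x}"
  by (rule span_subspace) (auto simp: subspace_def)

lemma line_subspace: "l \<in> L \<Longrightarrow> subspace P L l"
  unfolding subspace_def using line_unique line_subset by (metis order_refl psubset_imp_subset)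

lemma span_pair:
  assumes "l \<in> L" "x \<in> l" "y \<in> l" "x \<noteq> y"
  shows "cl {x, y} = l"
proof
  show "cl {x, y} \<subseteq> l" using span_least[OF line_subspace[OF assms(1)], of "{x, y}"] assms by simp
  have "x \<in> P" "y \<in> P" using assms line_subset by blast+
  then have "subspace P L (cl {x, y})" by (simp add: subspace_span)
  then show "l \<subseteq> cl {x, y}"
    using subspace_line[of "cl {x, y}" l x y] assms subset_span[of "{x, y}" P L] by blast
qed

lemma collinear_iff_span:
  assumes "x \<in> P" "y \<in> P" "z \<in> P" "x \<noteq> y"
  shows "collinear L {x, y, z} \<longleftrightarrow> z \<in> cl {x, y}"
proof
  assume "collinear L {x, y, z}"
  then show "z \<in> cl {x, y}" using assms span_pair unfolding collinear_def by force
next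
  assume z: "z \<in> cl {x, y}"
  obtain l where "l \<in> L" "x \<in> l" "y \<in> l" using line_exists assms by blast
  then show "collinear L {x, y, z}" using z assms span_pair unfolding collinear_def by force
qed

text \<open>Such a triple is covered by two points. If these coincide, a line must still be found,
  and \<open>w\<close> guarantees a second point to draw it through.\<close>

lemma collinear_degenerate:
  assumes "x \<in> P" "y \<in> P" "z \<in> P" "w \<in> P" "w \<noteq> x" "x = y \<or> x = z \<or> y = z"
  shows "collinear L {x, y, z}"
proof -
  have pair: "collinear L {a, b}" if "a \<in> P" "b \<in> P" for a b
  proof (cases "a = b")
    case True
    have "\<exists>c\<in>P. c \<noteq> a" using assms by metis
    then obtain c where "c \<in> P" "c \<noteq> a" by blast
    then show ?thesis using line_exists[of a c] that True unfolding collinear_def by auto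
  next
    case False
    then show ?thesis using line_exists[of a b] that unfolding collinear_def by auto
  qed
  have "{x, y, z} = {x, z} \<or> {x, y, z} = {x, y}" using assms(6) by auto
  then show ?thesis using pair assms by metis
qed

text \<open>Gives access to the plane axiom before exchange is available. Minimality is therefore
  checked by hand: at most two points span at most a line, which cannot hold a non-collinear
  triple.\<close>

lemma has_dim_plane:
  assumes P: "x \<in> P" "y \<in> P" "z \<in> P" and xy: "x \<noteq> y" and z: "z \<notin> cl {x, y}"
  shows "has_dim P L (cl {x, y, z}) 2"
proof -
  have xyz: "z \<noteq> x" "z \<noteq> y" using z span_superset[of _ "{x, y}" P L] by auto
  have "Suc 2 \<le> card X" if X: "X \<subseteq> P" "finite X" "cl X = cl {x, y, z}" for X
  proof (rule ccontr)
    assume "\<not> Suc 2 \<le> card X"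
    then consider "card X = 0" | "card X = 1" | "card X = 2" by linarith
    moreover have mem: "x \<in> cl X" "y \<in> cl X" "z \<in> cl X"
      using X(3) span_superset[of _ "{x, y, z}" P L] by auto
    ultimately show False
    proof cases
      case 1
      then show False using X mem span_empty by simp
    next
      case 2
      then obtain a where a: "X = {a}" by (auto simp: card_1_singleton_iff)
      then have "cl X = {a}" using X(1) span_singleton[of a] by simp
      then show False using mem(1,2) xy by simp
    next
      case 3
      then obtain a b where ab: "X = {a, b}" "a \<noteq> b" by (auto simp: card_2_iff)
      then obtain l where l: "l \<in> L" "a \<in> l" "b \<in> l" using line_exists[of a b] X by auto
      then have "cl X = l" using span_pair[OF l ab(2)] ab by simp
      then have "cl {x, y} = l" "z \<in> l" using span_pair[of l x y] l mem xy by auto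
      then show False using z by simp
    qed
  qed
  moreover have "card {x, y, z} = Suc 2" using xy xyz by auto
  ultimately show ?thesis
    unfolding has_dim_def using subspace_span[of "{x, y, z}"] P
    by (intro conjI exI[of _ "{x, y, z}"]) auto
qed

lemma subspace_Int: "subspace P L S \<Longrightarrow> subspace P L T \<Longrightarrow> subspace P L (S \<inter> T)"
  unfolding subspace_def by (metis IntD1 IntD2 le_infI1 le_inf_iff)

lemma subspace_span_mem: "subspace P L S \<Longrightarrow> X \<subseteq> S \<Longrightarrow> z \<in> cl X \<Longrightarrow> z \<in> S"
  using span_least by (rule subsetD)

text \<open>The two-point case of exchange, which holds in every linear space because any two points
  of a line determine it.\<close>

lemma span_pair_exchange:
  assumes "x \<in> P" "h \<in> P" "y \<in> cl {x, h}" "y \<noteq> h" "x \<noteq> h"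
  shows "x \<in> cl {y, h}"
proof -
  obtain l where l: "l \<in> L" "x \<in> l" "h \<in> l" using line_exists assms by blast
  then have "y \<in> l" using span_pair[OF l assms(5)] assms by simp
  then show ?thesis using span_pair[of l y h] l assms by simp
qed

end


section \<open>Linear spaces with the exchange property\<close>

text \<open>The common ground of a projective space and its dual: exchange over finite sets and a
  finite base. Working here makes every result available for the dual without showing that it is
  projective.\<close>

locale exchange_space = lspace P L for P :: "'a set" and L :: "'a set set" +
  fixes n :: nat
  assumes exchange: "\<lbrakk>finite A; A \<subseteq> P; x \<in> P; y \<in> cl (insert x A); y \<notin> cl A\<rbrakk> \<Longrightarrow> x \<in> cl (insert y A)"
    and base_exists: "\<exists>B\<subseteq>P. finite B \<and> card B = Suc n \<and> cl B = P \<and> (\<forall>x\<in>B. x \<notin> cl (B - {x}))"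
begin

text \<open>Point-by-point form of independence with finiteness built in. Both differences from
  \<open>independent\<close> disappear in \<open>independent_iff\<close>.\<close>

definition indep :: "'a set \<Rightarrow> bool" where
  "indep X \<longleftrightarrow> X \<subseteq> P \<and> finite X \<and> (\<forall>x\<in>X. x \<notin> cl (X - {x}))"

definition base :: "'a set \<Rightarrow> bool" where
  "base B \<longleftrightarrow> indep B \<and> cl B = P"

lemma indep_insert:
  assumes I: "indep I" and y: "y \<in> P" "y \<notin> cl I"
  shows "indep (insert y I)"
proof -
  have yI: "y \<notin> I" using y(2) span_superset by metis
  have "x \<notin> cl (insert y I - {x})" if x: "x \<in> insert y I" for x
  proof (cases "x = y")
    case True
    then show ?thesis using y yI by simp
  next
    case False
    then have xI: "x \<in> I" using x by simp
    show ?thesis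
    proof
      assume "x \<in> cl (insert y I - {x})"
      then have "x \<in> cl (insert y (I - {x}))" using False by (simp add: insert_Diff_if)
      moreover have "x \<notin> cl (I - {x})" using I xI unfolding indep_def by blast
      \<comment> \<open>Exchange turns a dependence of \<open>x\<close> on \<open>y\<close> into one
        of \<open>y\<close> on \<open>I\<close>.\<close>
      ultimately have "y \<in> cl (insert x (I - {x}))"
        using exchange[of "I - {x}" y x] I y unfolding indep_def by blast
      then show False using y xI by (simp add: insert_absorb)
    qed
  qed
  then show ?thesis using I y unfolding indep_def by blast
qed

lemma indep_subset: "indep J \<Longrightarrow> I \<subseteq> J \<Longrightarrow> indep I"
  unfolding indep_def by (meson Diff_mono finite_subset order_refl span_mono subsetD subset_trans)

lemma indep_empty: "indep {}"
  unfolding indep_def by simp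

text \<open>Steinitz exchange: a point of \<open>I\<close> outside \<open>F\<close> is traded for a
  point of \<open>F\<close> that the rest of \<open>I\<close> does not span. The size of
  \<open>I\<close> is kept while \<open>I - F\<close> shrinks.\<close>

lemma indep_card_le:
  assumes "indep I" "finite F" "F \<subseteq> P" "I \<subseteq> cl F"
  shows "card I \<le> card F"
  using assms
proof (induction "card (I - F)" arbitrary: I rule: less_induct)
  case less
  show ?case
  proof (cases "I \<subseteq> F")
    case True
    then show ?thesis using less.prems card_mono by blast
  next
    case False
    then obtain y where y: "y \<in> I" "y \<notin> F" by blast
    have "\<not> F \<subseteq> cl (I - {y})"
    proof
      assume "F \<subseteq> cl (I - {y})"
      then have "y \<in> cl (I - {y})" using span_trans[of F P L "I - {y}" y] less.prems(4) y(1) by blast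
      then show False using less.prems(1) y(1) unfolding indep_def by blast
    qed
    then obtain z where z: "z \<in> F" "z \<notin> cl (I - {y})" by blast
    have fin: "finite I" using less.prems(1) unfolding indep_def by blast
    have zI: "z \<notin> I - {y}" using z(2) span_superset by metis
    let ?I = "insert z (I - {y})"
    have "indep ?I"
      using less.prems z by (intro indep_insert indep_subset[OF less.prems(1)]) auto
    moreover have "?I \<subseteq> cl F" using less.prems(4) z(1) subset_span[of F P L] by blast
    moreover have "card (?I - F) < card (I - F)"
      using y z fin by (intro psubset_card_mono) auto
    ultimately have "card ?I \<le> card F" using less by blast
    moreover have "card ?I = card I"
      using zI fin y(1) by (metis card.remove card_insert_disjoint finite_Diff)
    ultimately show ?thesis by simp
  qed
qed

lemma indep_card_eq:
  assumes "indep I" "indep J" "cl I = cl J"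
  shows "card I = card J"
  using indep_card_le[OF assms(1), of J] indep_card_le[OF assms(2), of I] assms
    subset_span[of I P L] subset_span[of J P L] unfolding indep_def by auto

lemma indep_card_bound:
  assumes "indep I"
  shows "card I \<le> Suc n"
proof -
  obtain B where "B \<subseteq> P" "finite B" "card B = Suc n" "cl B = P" using base_exists by blast
  then show ?thesis using indep_card_le[of I B] assms unfolding indep_def by simp
qed

text \<open>\<open>A\<close> may be infinite, so points are added greedily; this stops because
  independent sets have at most \<open>Suc n\<close> points.\<close>

lemma indep_extend:
  assumes "indep I" "I \<subseteq> A" "A \<subseteq> P"
  shows "\<exists>J. I \<subseteq> J \<and> J \<subseteq> A \<and> indep J \<and> cl J = cl A"
  using assms
proof (induction "Suc n - card I" arbitrary: I rule: less_induct)
  case less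
  show ?case
  proof (cases "A \<subseteq> cl I")
    case True
    then show ?thesis using less.prems span_absorb[of A P L I] by blast
  next
    case False
    then obtain y where y: "y \<in> A" "y \<notin> cl I" by blast
    then have ind: "indep (insert y I)" using indep_insert less.prems by blast
    have "y \<notin> I" using y(2) span_superset by metis
    then have "card (insert y I) = Suc (card I)" using less.prems(1) unfolding indep_def by simp
    then have "Suc n - card (insert y I) < Suc n - card I"
      using indep_card_bound[OF ind] by linarith
    then obtain J where "insert y I \<subseteq> J \<and> J \<subseteq> A \<and> indep J \<and> cl J = cl A"
      using less.hyps[of "insert y I"] ind y(1) less.prems(2,3) by auto
    then show ?thesis by auto
  qed
qed

section \<open>Bases and dimension\<close>

lemma base_extend: "indep I \<Longrightarrow> \<exists>B. I \<subseteq> B \<and> base B"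
  using indep_extend[of I P] span_carrier indep_def unfolding base_def by auto

lemma baseD: "base B \<Longrightarrow> finite B" "base B \<Longrightarrow> B \<subseteq> P" "base B \<Longrightarrow> indep B" "base B \<Longrightarrow> cl B = P"
  unfolding base_def indep_def by auto

lemma base_card: assumes "base B" shows "card B = Suc n"
proof -
  obtain A where A: "A \<subseteq> P" "finite A" "card A = Suc n" "cl A = P" "\<forall>x\<in>A. x \<notin> cl (A - {x})"
    using base_exists by blast
  then have "indep A" unfolding indep_def by blast
  then have "card A \<le> card B" using indep_card_le[of A B] baseD[OF assms] A by simp
  moreover have "card B \<le> Suc n" using indep_card_bound assms baseD by blast
  ultimately show ?thesis using A by simp
qed

lemma indep_card_base:
  assumes "indep I" "card I = Suc n"
  shows "base I"
proof -
  obtain B where B: "I \<subseteq> B" "base B" using base_extend assms by blast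
  then have "I = B" using base_card[OF B(2)] baseD[OF B(2)] assms by (metis card_subset_eq)
  then show ?thesis using B by simp
qed

text \<open>A spanning set of least size contains an independent set with the same span and must
  equal it; conversely, the Steinitz bound gives every independent spanning set least size.\<close>

lemma has_dim_iff: "has_dim P L S m \<longleftrightarrow> (\<exists>I. indep I \<and> card I = Suc m \<and> cl I = S)"
proof
  assume h: "has_dim P L S m"
  then obtain X where X: "X \<subseteq> P" "finite X" "card X = Suc m" "cl X = S"
    unfolding has_dim_def by blast
  obtain J where J: "J \<subseteq> X" "indep J" "cl J = cl X" using indep_extend[OF indep_empty, of X] X by auto
  have "J \<subseteq> P" "finite J" using J(2) unfolding indep_def by auto
  then have "Suc m \<le> card J" using h J(3) X(4) unfolding has_dim_def by simp
  then have "J = X" using J X card_seteq by metis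
  then show "\<exists>I. indep I \<and> card I = Suc m \<and> cl I = S" using J X by blast
next
  assume "\<exists>I. indep I \<and> card I = Suc m \<and> cl I = S"
  then obtain I where I: "indep I" "card I = Suc m" "cl I = S" by blast
  have "Suc m \<le> card X" if "X \<subseteq> P" "finite X" "cl X = S" for X
    using indep_card_le[of I X] I that subset_span[of I P L] by simp
  moreover have "I \<subseteq> P" "finite I" using I unfolding indep_def by auto
  ultimately show "has_dim P L S m" using I subspace_span[of I] unfolding has_dim_def by auto
qed

text \<open>An \<open>independent\<close> set cannot be infinite: it contains an
  \<open>indep\<close> set with the same span, which must be all of it.\<close>

lemma independent_iff: "independent P L X \<longleftrightarrow> indep X"
proof
  assume h: "independent P L X"
  then have XP: "X \<subseteq> P" unfolding independent_def by blast
  then obtain J where J: "J \<subseteq> X" "indep J" "cl J = cl X" using indep_extend[OF indep_empty, of X] by auto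
  then show "indep X" using h unfolding independent_def by (metis psubsetI)
next
  assume h: "indep X"
  have "cl Y \<noteq> cl X" if Y: "Y \<subset> X" for Y
  proof
    assume eq: "cl Y = cl X"
    obtain x where x: "x \<in> X" "x \<notin> Y" using Y by blast
    then have "x \<in> cl Y" using eq span_superset by metis
    then have "x \<in> cl (X - {x})" using span_mono[of Y "X - {x}" P L] x Y by blast
    then show False using h x unfolding indep_def by blast
  qed
  then show "independent P L X" using h unfolding independent_def indep_def by blast
qed

lemma is_base_iff: "is_base P L B \<longleftrightarrow> base B"
  unfolding is_base_def base_def independent_iff by simp

section \<open>Spans of subsets of a base\<close>

lemma base_span_mem:
  assumes "base B" "X \<subseteq> B" "b \<in> B" "b \<in> cl X"
  shows "b \<in> X"
proof (rule ccontr)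
  assume "b \<notin> X"
  then have "b \<in> cl (B - {b})" using assms span_mono[of X "B - {b}" P L] by blast
  then show False using assms unfolding base_def indep_def by blast
qed

lemma base_span_inj:
  assumes "base B" "X \<subseteq> B" "Y \<subseteq> B" "cl X = cl Y"
  shows "X = Y"
proof
  show "X \<subseteq> Y" using base_span_mem[OF assms(1,3)] assms subset_span[of X P L] by blast
  show "Y \<subseteq> X" using base_span_mem[OF assms(1,2)] assms subset_span[of Y P L] by blast
qed

text \<open>\<open>C\<close> is the support of \<open>z\<close>, a minimal subset of
  \<open>B\<close> that spans \<open>z\<close>. By exchange, each \<open>c\<close> in
  \<open>C\<close> is spanned by \<open>z\<close> and \<open>C - {c}\<close>; if \<open>X\<close>
  spans \<open>z\<close>, then \<open>C - {c}\<close> and \<open>X\<close> together span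
  \<open>c\<close>, so \<open>c\<close> lies in \<open>X\<close>. Later arguments bound such a
  support by intersecting several \<open>X\<close>.\<close>

lemma base_support:
  assumes B: "base B" and z: "z \<in> P"
  shows "\<exists>C\<subseteq>B. \<forall>X\<subseteq>B. z \<in> cl X \<longleftrightarrow> C \<subseteq> X"
proof -
  have "finite {C. C \<subseteq> B \<and> z \<in> cl C}" using baseD(1)[OF B] by simp
  moreover have "B \<in> {C. C \<subseteq> B \<and> z \<in> cl C}" using baseD(4)[OF B] z by simp
  ultimately obtain C where C: "C \<subseteq> B" "z \<in> cl C"
    and min: "\<And>D. D \<subseteq> B \<Longrightarrow> z \<in> cl D \<Longrightarrow> D \<subseteq> C \<Longrightarrow> C = D"
    using finite_has_minimal2[of "{C. C \<subseteq> B \<and> z \<in> cl C}" B] by auto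
  have "C \<subseteq> X" if X: "X \<subseteq> B" "z \<in> cl X" for X
  proof
    fix c assume c: "c \<in> C"
    have "z \<notin> cl (C - {c})" using min[of "C - {c}"] c C by blast
    moreover have "z \<in> cl (insert c (C - {c}))" using C c by (simp add: insert_absorb)
    ultimately have "c \<in> cl (insert z (C - {c}))"
      using exchange[of "C - {c}" c z] C c baseD[OF B] by (meson finite_Diff finite_subset subset_trans Diff_subset subsetD)
    moreover have "insert z (C - {c}) \<subseteq> cl ((C - {c}) \<union> X)"
      using X subset_span[of "(C - {c}) \<union> X" P L] span_mono[of X "(C - {c}) \<union> X" P L] by blast
    ultimately have "c \<in> cl ((C - {c}) \<union> X)" by (meson span_trans)
    then have "c \<in> (C - {c}) \<union> X" using base_span_mem[OF B, of "(C - {c}) \<union> X" c] c C X by blast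
    then show "c \<in> X" by blast
  qed
  then have "\<forall>X\<subseteq>B. z \<in> cl X \<longleftrightarrow> C \<subseteq> X" using C span_mono[of C _ P L] by blast
  then show ?thesis using C by blast
qed

definition subsets_span :: "nat \<Rightarrow> 'a set \<Rightarrow> 'a set set" where
  "subsets_span m B = cl ` {X. X \<subseteq> B \<and> card X = m}"

text \<open>Subsets of a base are independent, so one that spans a \<open>k\<close>-dimensional
  subspace has exactly \<open>Suc k\<close> points.\<close>

lemma base_subset_of_eq:
  assumes "base B"
  shows "base_subset_of P L k B = subsets_span (Suc k) B"
proof
  show "base_subset_of P L k B \<subseteq> subsets_span (Suc k) B"
  proof
    fix S assume "S \<in> base_subset_of P L k B"
    then obtain X I where X: "X \<subseteq> B" "cl X = S" and I: "indep I" "card I = Suc k" "cl I = S"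
      unfolding base_subset_of_def Gr_def has_dim_iff by blast
    have iX: "indep X" using indep_subset X(1) baseD(3)[OF assms] by blast
    have "card X = card I" using indep_card_eq[OF iX I(1)] I X by simp
    then show "S \<in> subsets_span (Suc k) B" using X I unfolding subsets_span_def by auto
  qed
  show "subsets_span (Suc k) B \<subseteq> base_subset_of P L k B"
    using indep_subset baseD(3)[OF assms]
    unfolding subsets_span_def base_subset_of_def Gr_def has_dim_iff by blast
qed

section \<open>Chains and comparison of bases\<close>

lemma base_exchange:
  assumes "base B" "b \<in> B" "c \<in> P" "c \<notin> cl (B - {b})"
  shows "base (insert c (B - {b}))"
proof -
  have "indep (insert c (B - {b}))" using assms indep_insert indep_subset baseD(3) by blast
  moreover have "c \<notin> B - {b}" using assms(4) span_superset by metis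
  then have "card (insert c (B - {b})) = Suc n"
    using assms base_card baseD(1) by (metis card.remove card_insert_disjoint finite_Diff)
  ultimately show ?thesis by (rule indep_card_base)
qed

text \<open>Induction on the number of points of \<open>B\<close> outside \<open>B0\<close>.
  Replacing one of them by a point of \<open>B0\<close> gives a base closer to \<open>B0\<close>,
  where \<open>Q\<close> holds by induction, and \<open>step\<close> carries \<open>Q\<close> back
  to \<open>B\<close>. Only points outside \<open>B0\<close> are removed, so \<open>K\<close>
  survives.\<close>

lemma base_connected:
  assumes "base B0" "base B" "K \<subseteq> B0" "K \<subseteq> B" "Q B0"
    and step: "\<And>A x y. \<lbrakk>K \<subseteq> A; x \<notin> A; y \<notin> A; base (insert x A); base (insert y A); Q (insert x A)\<rbrakk> \<Longrightarrow> Q (insert y A)"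
  shows "Q B"
  using assms(2,4)
proof (induction "card (B - B0)" arbitrary: B rule: less_induct)
  case less
  show ?case
  proof (cases "B \<subseteq> B0")
    case True
    then have "B = B0"
      using base_card[OF assms(1)] base_card[OF less.prems(1)] baseD(1)[OF assms(1)] by (metis card_subset_eq)
    then show ?thesis using assms by simp
  next
    case False
    then obtain b where b: "b \<in> B" "b \<notin> B0" by blast
    have "\<not> B0 \<subseteq> cl (B - {b})"
    proof
      assume "B0 \<subseteq> cl (B - {b})"
      then have "P \<subseteq> cl (B - {b})" using span_subset_span baseD(4)[OF assms(1)] by metis
      then show False using less.prems(1) b unfolding base_def indep_def by blast
    qed
    then obtain c where c: "c \<in> B0" "c \<notin> cl (B - {b})" by blast
    have cb: "c \<notin> B - {b}" using c(2) span_superset by metis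
    have bas: "base (insert c (B - {b}))"
      using base_exchange less.prems(1) b c baseD(2)[OF assms(1)] by blast
    have "card (insert c (B - {b}) - B0) < card (B - B0)"
      using b c baseD(1)[OF less.prems(1)] by (intro psubset_card_mono) auto
    moreover have K: "K \<subseteq> B - {b}" using less.prems(2) b assms(3) by blast
    ultimately have "Q (insert c (B - {b}))" using less.hyps bas by blast
    moreover have "insert b (B - {b}) = B" using b by blast
    ultimately show ?thesis using step[of "B - {b}" c b] K cb bas less.prems(1) by simp
  qed
qed

lemma two_points_base:
  assumes "x \<in> P" "y \<in> P"
  shows "\<exists>B. base B \<and> x \<in> B \<and> y \<in> B"
proof -
  have "indep {x}" using indep_insert[OF indep_empty] assms span_empty by simp
  then have "indep {y, x}"
    using indep_insert[of "{x}" y] assms span_singleton by (cases "x = y") auto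
  then show ?thesis using base_extend by blast
qed

lemma noncollinear_indep:
  assumes "x \<in> P" "y \<in> P" "z \<in> P" "x \<noteq> y" "z \<notin> cl {x, y}"
  shows "indep {x, y, z}"
proof -
  obtain B where "base B" "x \<in> B" "y \<in> B" using two_points_base assms by blast
  then have "indep {x, y}" using indep_subset[of B "{x, y}"] baseD by blast
  then have "indep (insert z {x, y})" using indep_insert assms by blast
  then show ?thesis by (simp add: insert_commute)
qed

text \<open>If \<open>b\<close> is a point of \<open>B1\<close> outside \<open>B2\<close>, then the points of \<open>B2\<close> needed to span \<open>b\<close> lie in
  every common element through \<open>b\<close>; if these elements had no further point of \<open>B1\<close> in common,
  they would meet in \<open>b\<close> alone, forcing \<open>b \<in> B2\<close>.\<close>

lemma distinct_bases_common:
  assumes B1: "base B1" and B2: "base B2" and ne: "B1 \<noteq> B2"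
  shows "\<exists>i\<in>B1. \<exists>j\<in>B1. i \<noteq> j \<and> (\<forall>X\<subseteq>B1. (\<exists>Y\<subseteq>B2. cl X = cl Y) \<longrightarrow> i \<in> X \<longrightarrow> j \<in> X)"
proof -
  have "\<not> B1 \<subseteq> B2" using ne base_card[OF B1] base_card[OF B2] baseD(1)[OF B2] by (metis card_subset_eq)
  then obtain b where b: "b \<in> B1" "b \<notin> B2" by blast
  then have bP: "b \<in> P" using baseD(2)[OF B1] by blast
  obtain C where C: "C \<subseteq> B2" "\<forall>X\<subseteq>B2. b \<in> cl X \<longleftrightarrow> C \<subseteq> X" using base_support[OF B2 bP] by blast
  have "C \<noteq> {}" using C span_empty by (metis empty_iff empty_subsetI subset_refl)
  then obtain c where c: "c \<in> C" by blast
  then have cP: "c \<in> P" using C(1) baseD(2)[OF B2] by blast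
  obtain D where D: "D \<subseteq> B1" "\<forall>X\<subseteq>B1. c \<in> cl X \<longleftrightarrow> D \<subseteq> X" using base_support[OF B1 cP] by blast
  have "\<not> D \<subseteq> {b}"
  proof
    assume "D \<subseteq> {b}"
    then have "c \<in> cl {b}" using D b by simp
    then show False using span_singleton[OF bP] b c C by auto
  qed
  then obtain j where j: "j \<in> D" "j \<noteq> b" by blast
  have "j \<in> X" if X: "X \<subseteq> B1" "Y \<subseteq> B2" "cl X = cl Y" "b \<in> X" for X Y
  proof -
    have "b \<in> cl Y" using X(3,4) span_superset[of b X P L] by simp
    then have "c \<in> Y" using C c X by blast
    then have "c \<in> cl X" using X(3) span_superset[of c Y P L] by simp
    then show ?thesis using D X j by blast
  qed
  moreover have "j \<in> B1" using j D by blast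
  ultimately show ?thesis using b(1) j(2) by (intro bexI[of _ b] bexI[of _ j]) auto
qed

text \<open>If \<open>p\<close> were in the span of \<open>B - {i}\<close>, so would be the whole
  line through \<open>p\<close> and \<open>j\<close>, including \<open>i\<close>.\<close>

lemma line_third_point_base:
  assumes B: "base B" and ij: "i \<in> B" "j \<in> B" "i \<noteq> j"
    and p: "p \<in> cl {i, j}" "p \<noteq> i" "p \<noteq> j"
  shows "base (insert p (B - {i}))" "p \<notin> B"
proof -
  have P: "i \<in> P" "j \<in> P" "{i, j} \<subseteq> P" using ij baseD[OF B] by auto
  have pP: "p \<in> P" using p span_closed[OF P(3)] by blast
  show "p \<notin> B" using base_span_mem[OF B, of "{i, j}" p] ij p by blast
  have "p \<notin> cl {j}" using span_singleton P p by blast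
  then have ip: "i \<in> cl {p, j}" using exchange[of "{j}" i p] p P by (simp add: insert_commute)
  have "p \<notin> cl (B - {i})"
  proof
    assume "p \<in> cl (B - {i})"
    then have "{p, j} \<subseteq> cl (B - {i})" using ij subset_span[of "B - {i}" P L] by blast
    then have "i \<in> cl (B - {i})" using ip by (meson span_trans)
    then show False using B ij unfolding base_def indep_def by blast
  qed
  then show "base (insert p (B - {i}))" using base_exchange B ij pP by blast
qed

text \<open>With \<open>j\<close> at hand, \<open>i\<close> and \<open>p\<close> determine each
  other on their common line, so swapping them leaves the span unchanged.\<close>

lemma line_third_point_span:
  assumes P: "i \<in> P" "j \<in> P" and p: "p \<in> cl {i, j}" "p \<noteq> j"
    and X: "i \<in> X" "j \<in> X" "i \<noteq> j"
  shows "cl X = cl (insert p (X - {i}))"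
proof -
  have "p \<notin> cl {j}" using span_singleton P p by blast
  then have ip: "i \<in> cl {p, j}" using exchange[of "{j}" i p] p P by (simp add: insert_commute)
  have "i \<in> cl (insert p (X - {i}))" using ip X span_mono[of "{p, j}" "insert p (X - {i})" P L] by blast
  then have "X \<subseteq> cl (insert p (X - {i}))" using subset_span[of "insert p (X - {i})" P L] by blast
  moreover have "p \<in> cl X" using p X span_mono[of "{i, j}" X P L] by blast
  then have "insert p (X - {i}) \<subseteq> cl X" using subset_span[of X P L] by blast
  ultimately show ?thesis by (simp add: span_subset_span subset_antisym)
qed

end

section \<open>Permutations of subsets of a fixed size\<close>

lemma subset_of_card_between:
  assumes "finite B" "Y \<subseteq> B" "Z \<subseteq> B" "Y \<inter> Z = {}" "card Y \<le> m" "m + card Z \<le> card B"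
  shows "\<exists>X. Y \<subseteq> X \<and> X \<subseteq> B \<and> card X = m \<and> X \<inter> Z = {}"
proof -
  have "card (B - Z) = card B - card Z" using assms by (meson card_Diff_subset finite_subset)
  then have "m \<le> card (B - Z)" using assms by linarith
  moreover have "Y \<subseteq> B - Z" "finite (B - Z)" using assms by auto
  ultimately obtain X where "Y \<subseteq> X" "X \<subseteq> B - Z" "card X = m"
    using exists_subset_between[of Y m "B - Z"] assms by blast
  then show ?thesis by blast
qed

text \<open>Removing \<open>i\<close> leaves an arbitrary \<open>(m - 1)\<close>-subset of
  \<open>B - {i, j}\<close>. What matters later is that the count depends only on
  \<open>card B\<close> and \<open>m\<close>, so that it agrees in both spaces.\<close>

lemma card_subsets_separating:
  assumes "finite B" "i \<in> B" "j \<in> B" "i \<noteq> j" "0 < m"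
  shows "card {X. X \<subseteq> B \<and> card X = m \<and> i \<in> X \<and> j \<notin> X} = (card B - 2) choose (m - 1)"
proof -
  let ?C = "B - {i, j}"
  have fin: "finite X" if "X \<subseteq> B" for X using that assms(1) finite_subset by blast
  have "{X. X \<subseteq> B \<and> card X = m \<and> i \<in> X \<and> j \<notin> X} = insert i ` {Y. Y \<subseteq> ?C \<and> card Y = m - 1}"
    (is "?A = ?R")
  proof
    show "?A \<subseteq> ?R"
    proof
      fix X assume X: "X \<in> ?A"
      then have "X - {i} \<subseteq> ?C" "card (X - {i}) = m - 1" "X = insert i (X - {i})"
        using fin by auto
      then show "X \<in> ?R" by blast
    qed
    show "?R \<subseteq> ?A"
    proof
      fix X assume "X \<in> ?R"
      then obtain Y where Y: "Y \<subseteq> ?C" "card Y = m - 1" "X = insert i Y" by blast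
      then have "finite Y" "i \<notin> Y" using fin[of Y] by auto
      then show "X \<in> ?A" using Y assms by auto
    qed
  qed
  moreover have "inj_on (insert i) {Y. Y \<subseteq> ?C \<and> card Y = m - 1}"
    by (rule inj_onI) blast
  moreover have "card ?C = card B - 2" using assms by (simp add: card_Diff_subset)
  ultimately show ?thesis using n_subsets[of ?C "m - 1"] assms by (simp add: card_image)
qed

text \<open>Here \<open>\<sigma>\<close> maps \<open>C i j\<close> to \<open>C (s i j) (t i j)\<close>, and \<open>adj\<close> expresses disjointness of two such sets.
  Pairs with a common source or a common target have at least three common neighbours for this
  relation, other unrelated pairs have only two.\<close>

locale pair_map =
  fixes B :: "'a set" and B' :: "'b set" and s t :: "'a \<Rightarrow> 'a \<Rightarrow> 'b"
  assumes four: "finite B" "4 \<le> card B"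
    and st: "\<lbrakk>i \<in> B; j \<in> B; i \<noteq> j\<rbrakk> \<Longrightarrow> s i j \<in> B' \<and> t i j \<in> B' \<and> s i j \<noteq> t i j"
    and inj: "\<lbrakk>i \<in> B; j \<in> B; i \<noteq> j; k \<in> B; l \<in> B; k \<noteq> l; s i j = s k l; t i j = t k l\<rbrakk> \<Longrightarrow> i = k \<and> j = l"
    and adj: "\<lbrakk>i \<in> B; j \<in> B; i \<noteq> j; k \<in> B; l \<in> B; k \<noteq> l\<rbrakk> \<Longrightarrow>
       (s i j = t k l \<or> t i j = s k l) \<longleftrightarrow> (i = l \<or> j = k)"
begin

lemma three_others:
  assumes "i \<in> B"
  shows "\<exists>a b c. {a, b, c} \<subseteq> B - {i} \<and> a \<noteq> b \<and> a \<noteq> c \<and> b \<noteq> c"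
proof -
  have "3 \<le> card (B - {i})" using four assms by simp
  then obtain T where "T \<subseteq> B - {i}" "card T = 3" by (meson obtain_subset_with_card_n)
  then show ?thesis by (auto simp: card_3_iff)
qed

text \<open>Every \<open>(x, i)\<close> is adjacent to both \<open>(i, j)\<close> and
  \<open>(i, l)\<close>. If their images share neither source nor target, only two pairs are
  adjacent to both images, yet there are three choices of \<open>x\<close>.\<close>

lemma same_source:
  assumes "i \<in> B" "j \<in> B" "l \<in> B" "i \<noteq> j" "i \<noteq> l" "j \<noteq> l"
  shows "s i j = s i l \<or> t i j = t i l"
proof (rule ccontr)
  assume neg: "\<not> (s i j = s i l \<or> t i j = t i l)"
  obtain a b c where abc: "a \<in> B" "b \<in> B" "c \<in> B" "a \<noteq> i" "b \<noteq> i" "c \<noteq> i" "a \<noteq> b" "a \<noteq> c" "b \<noteq> c"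
    using three_others[OF assms(1)] by auto
  have two: "(s x i = t i l \<and> t x i = s i j) \<or> (s x i = t i j \<and> t x i = s i l)"
    if x: "x \<in> B" "x \<noteq> i" for x
    using adj[of i j x i] adj[of i l x i] assms x neg by auto
  show False
    using two[of a] two[of b] two[of c] inj[of a i b i] inj[of a i c i] inj[of b i c i] abc assms(1)
    by metis
qed

text \<open>Two pairs out of \<open>i\<close> whose images share a source have images with distinct
  targets, so a pair into \<open>i\<close> can be adjacent to both only through that source. Hence
  it is the target for all pairs into \<open>i\<close>, and then the source for all pairs out of
  \<open>i\<close>. The other case mirrors this.\<close>

lemma pointwise:
  assumes i: "i \<in> B"
  shows "\<exists>\<tau>. (\<forall>j\<in>B - {i}. s i j = \<tau> \<and> t j i = \<tau>) \<or> (\<forall>j\<in>B - {i}. t i j = \<tau> \<and> s j i = \<tau>)"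
proof -
  obtain a b where ab: "a \<in> B" "b \<in> B" "a \<noteq> i" "b \<noteq> i" "a \<noteq> b"
    using three_others[OF i] by auto
  from same_source[of i a b] ab i consider "s i a = s i b" | "t i a = t i b" by auto
  then show ?thesis
  proof cases
    case 1
    then have ne: "t i a \<noteq> t i b" using inj[of i a i b] ab i by auto
    have t: "t x i = s i a" if "x \<in> B" "x \<noteq> i" for x
      using adj[of i a x i] adj[of i b x i] ab i that 1 ne by auto
    have "s a i \<noteq> s b i" using inj[of a i b i] ab i t by auto
    then have "s i x = s i a" if "x \<in> B" "x \<noteq> i" for x
      using adj[of i x a i] adj[of i x b i] ab i that t by auto
    then show ?thesis using t by (intro exI[of _ "s i a"]) simp
  next
    case 2
    then have ne: "s i a \<noteq> s i b" using inj[of i a i b] ab i by auto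
    have t: "s x i = t i a" if "x \<in> B" "x \<noteq> i" for x
      using adj[of i a x i] adj[of i b x i] ab i that 2 ne by auto
    have "t a i \<noteq> t b i" using inj[of a i b i] ab i t by auto
    then have "t i x = t i a" if "x \<in> B" "x \<noteq> i" for x
      using adj[of i x a i] adj[of i x b i] ab i that t by auto
    then show ?thesis using t by (intro exI[of _ "t i a"]) simp
  qed
qed

lemma induced:
  "\<exists>\<tau>. (\<forall>i\<in>B. \<forall>j\<in>B. i \<noteq> j \<longrightarrow> s i j = \<tau> i \<and> t i j = \<tau> j) \<or>
       (\<forall>i\<in>B. \<forall>j\<in>B. i \<noteq> j \<longrightarrow> s i j = \<tau> j \<and> t i j = \<tau> i)"
proof -
  have "\<forall>i\<in>B. \<exists>\<tau>. (\<forall>j\<in>B - {i}. s i j = \<tau> \<and> t j i = \<tau>) \<or> (\<forall>j\<in>B - {i}. t i j = \<tau> \<and> s j i = \<tau>)"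
    using pointwise by simp
  from bchoice[OF this] obtain \<tau> where \<tau>: "\<forall>i\<in>B.
      (\<forall>j\<in>B - {i}. s i j = \<tau> i \<and> t j i = \<tau> i) \<or> (\<forall>j\<in>B - {i}. t i j = \<tau> i \<and> s j i = \<tau> i)"
    by (elim exE)
  define D where "D i \<longleftrightarrow> (\<forall>j\<in>B - {i}. s i j = \<tau> i \<and> t j i = \<tau> i)" for i
  define E where "E i \<longleftrightarrow> (\<forall>j\<in>B - {i}. t i j = \<tau> i \<and> s j i = \<tau> i)" for i
  have DE: "D i \<or> E i" if "i \<in> B" for i using \<tau> that unfolding D_def E_def by simp
  have Dd: "s i x = \<tau> i" "t x i = \<tau> i" if "D i" "x \<in> B" "x \<noteq> i" for i x
    using that unfolding D_def by auto
  have Ed: "t i x = \<tau> i" "s x i = \<tau> i" if "E i" "x \<in> B" "x \<noteq> i" for i x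
    using that unfolding E_def by auto
  \<comment> \<open>If both types occurred, \<open>s i j\<close> would force
    \<open>\<tau> i = \<tau> j\<close>. A third point \<open>l\<close> of either type then gets the
    same value, which yields a pair whose image has equal source and target.\<close>
  have mixed: False if "i \<in> B" "j \<in> B" "i \<noteq> j" "D i" "E j" for i j
  proof -
    obtain a b c where "{a, b, c} \<subseteq> B - {i}" "a \<noteq> b" using three_others[OF \<open>i \<in> B\<close>] by auto
    then obtain l where l: "l \<in> B" "l \<noteq> i" "l \<noteq> j" by (cases "a = j") auto
    have e: "\<tau> i = \<tau> j" using Dd(1)[of i j] Ed(2)[of j i] that by simp
    show False
    proof (cases "D l")
      case True
      then have "s i l = \<tau> i" "t i l = \<tau> l" "\<tau> l = \<tau> j"
        using Dd(1)[of i l] Dd(2)[of l i] Dd(1)[of l j] Ed(2)[of j l] that l by auto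
      then show False using st[of i l] that l e by simp
    next
      case False
      then have "E l" using DE l by blast
      then have "s j l = \<tau> l" "t j l = \<tau> j" "\<tau> l = \<tau> i"
        using Ed(2)[of l j] Ed(1)[of j l] Dd(1)[of i l] Ed(2)[of l i] that l by auto
      then show False using st[of j l] that l e by simp
    qed
  qed
  obtain i0 where i0: "i0 \<in> B" using four by fastforce
  show ?thesis
  proof (cases "D i0")
    case True
    then have "D i" if "i \<in> B" for i using mixed[of i0 i] DE that i0 by auto
    then show ?thesis unfolding D_def by (intro exI[of _ \<tau>] disjI1) auto
  next
    case False
    then have "E i0" using DE i0 by blast
    then have "E i" if "i \<in> B" for i using mixed[of i i0] DE that i0 by auto
    then show ?thesis unfolding E_def by (intro exI[of _ \<tau>] disjI2) auto
  qed
qed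

end

text \<open>The left side says that the families \<open>C i j\<close> and \<open>C k l\<close> meet;
  the bounds on \<open>m\<close> leave room for \<open>i\<close>, \<open>k\<close> inside and
  \<open>j\<close>, \<open>l\<close> outside.\<close>

lemma subset_separating_two_pairs:
  assumes "2 \<le> m" "m + 2 \<le> card A" "finite A"
    "i \<in> A" "j \<in> A" "i \<noteq> j" "k \<in> A" "l \<in> A" "k \<noteq> l"
  shows "(\<exists>X. X \<subseteq> A \<and> card X = m \<and> i \<in> X \<and> k \<in> X \<and> j \<notin> X \<and> l \<notin> X) \<longleftrightarrow> i \<noteq> l \<and> j \<noteq> k"
proof
  assume "i \<noteq> l \<and> j \<noteq> k"
  then have "{i, k} \<inter> {j, l} = {}" using assms by auto
  moreover have "card {i, k} \<le> m" "m + card {j, l} \<le> card A" using assms(1,2) by (auto simp: card_insert_if)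
  ultimately obtain X where "{i, k} \<subseteq> X \<and> X \<subseteq> A \<and> card X = m \<and> X \<inter> {j, l} = {}"
    using subset_of_card_between[of A "{i, k}" "{j, l}" m] assms by blast
  then show "\<exists>X. X \<subseteq> A \<and> card X = m \<and> i \<in> X \<and> k \<in> X \<and> j \<notin> X \<and> l \<notin> X" by blast
qed auto

text \<open>The pairs supplied by \<open>sep\<close> form a map as in \<open>pair_map\<close>:
  injective because distinct families \<open>C i j\<close> differ, and compatible with adjacency
  because \<open>\<sigma>\<close>, being onto, preserves whether two families meet. The induced
  \<open>\<tau>\<close> then tells which points lie in \<open>\<sigma> X\<close>.\<close>

lemma subset_bijection_induced:
  fixes B :: "'a set" and B' :: "'b set" and \<sigma> :: "'a set \<Rightarrow> 'b set"
  assumes fin: "finite B" "finite B'" "card B' = card B" and m: "2 \<le> m" "m + 2 \<le> card B"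
    and \<sigma>: "\<sigma> ` {X. X \<subseteq> B \<and> card X = m} = {X. X \<subseteq> B' \<and> card X = m}"
    and sep: "\<And>i j. \<lbrakk>i \<in> B; j \<in> B; i \<noteq> j\<rbrakk> \<Longrightarrow> \<exists>i'\<in>B'. \<exists>j'\<in>B'. i' \<noteq> j' \<and>
      (\<forall>X. X \<subseteq> B \<longrightarrow> card X = m \<longrightarrow> (i \<in> X \<and> j \<notin> X \<longleftrightarrow> i' \<in> \<sigma> X \<and> j' \<notin> \<sigma> X))"
  shows "\<exists>\<tau>. bij_betw \<tau> B B' \<and>
    ((\<forall>X. X \<subseteq> B \<longrightarrow> card X = m \<longrightarrow> \<sigma> X = \<tau> ` X) \<or>
     card B = 2 * m \<and> (\<forall>X. X \<subseteq> B \<longrightarrow> card X = m \<longrightarrow> \<sigma> X = B' - \<tau> ` X))"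
proof -
  have "\<forall>p. \<exists>q. fst p \<in> B \<and> snd p \<in> B \<and> fst p \<noteq> snd p \<longrightarrow> fst q \<in> B' \<and> snd q \<in> B' \<and> fst q \<noteq> snd q \<and>
     (\<forall>X. X \<subseteq> B \<longrightarrow> card X = m \<longrightarrow> (fst p \<in> X \<and> snd p \<notin> X \<longleftrightarrow> fst q \<in> \<sigma> X \<and> snd q \<notin> \<sigma> X))"
  proof
    fix p
    show "\<exists>q. fst p \<in> B \<and> snd p \<in> B \<and> fst p \<noteq> snd p \<longrightarrow> fst q \<in> B' \<and> snd q \<in> B' \<and> fst q \<noteq> snd q \<and>
     (\<forall>X. X \<subseteq> B \<longrightarrow> card X = m \<longrightarrow> (fst p \<in> X \<and> snd p \<notin> X \<longleftrightarrow> fst q \<in> \<sigma> X \<and> snd q \<notin> \<sigma> X))"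
      using sep[of "fst p" "snd p"] by fastforce
  qed
  from choice[OF this] obtain \<phi> where \<phi>: "\<forall>p. fst p \<in> B \<and> snd p \<in> B \<and> fst p \<noteq> snd p \<longrightarrow>
     fst (\<phi> p) \<in> B' \<and> snd (\<phi> p) \<in> B' \<and> fst (\<phi> p) \<noteq> snd (\<phi> p) \<and>
     (\<forall>X. X \<subseteq> B \<longrightarrow> card X = m \<longrightarrow> (fst p \<in> X \<and> snd p \<notin> X \<longleftrightarrow> fst (\<phi> p) \<in> \<sigma> X \<and> snd (\<phi> p) \<notin> \<sigma> X))"
    by blast
  define s where "s i j = fst (\<phi> (i, j))" for i j
  define t where "t i j = snd (\<phi> (i, j))" for i j
  have st: "s i j \<in> B' \<and> t i j \<in> B' \<and> s i j \<noteq> t i j" if "i \<in> B" "j \<in> B" "i \<noteq> j" for i j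
    using \<phi>[rule_format, of "(i, j)"] that unfolding s_def t_def by simp
  have sigma: "i \<in> X \<and> j \<notin> X \<longleftrightarrow> s i j \<in> \<sigma> X \<and> t i j \<notin> \<sigma> X"
    if "i \<in> B" "j \<in> B" "i \<noteq> j" "X \<subseteq> B" "card X = m" for i j X
    using \<phi>[rule_format, of "(i, j)"] that unfolding s_def t_def by simp
  interpret pair_map B B' s t
  proof
    show "finite B" "4 \<le> card B" using fin m by auto
    show "s i j \<in> B' \<and> t i j \<in> B' \<and> s i j \<noteq> t i j" if "i \<in> B" "j \<in> B" "i \<noteq> j" for i j
      using st that by blast
    show "i = k \<and> j = l"
      if h: "i \<in> B" "j \<in> B" "i \<noteq> j" "k \<in> B" "l \<in> B" "k \<noteq> l" "s i j = s k l" "t i j = t k l" for i j k l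
    proof -
      have eq: "(i \<in> X \<and> j \<notin> X) = (k \<in> X \<and> l \<notin> X)" if "X \<subseteq> B" "card X = m" for X
        using sigma[of i j X] sigma[of k l X] that h by simp
      have "i = k"
      proof (rule ccontr)
        assume ik: "i \<noteq> k"
        \<comment> \<open>Such an \<open>X\<close> belongs to \<open>C i j\<close> but not to
          \<open>C k l\<close>.\<close>
        have "\<exists>X. {i} \<subseteq> X \<and> X \<subseteq> B \<and> card X = m \<and> X \<inter> {j, k} = {}"
          using h ik m fin by (intro subset_of_card_between) (auto simp: card_insert_if)
        then show False using eq by blast
      qed
      moreover have "j = l"
      proof (rule ccontr)
        assume jl: "j \<noteq> l"
        have "\<exists>X. {i, l} \<subseteq> X \<and> X \<subseteq> B \<and> card X = m \<and> X \<inter> {j} = {}"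
          using h jl m fin \<open>i = k\<close> by (intro subset_of_card_between) (auto simp: card_insert_if)
        then show False using eq by blast
      qed
      ultimately show ?thesis by simp
    qed
    show "(s i j = t k l \<or> t i j = s k l) \<longleftrightarrow> (i = l \<or> j = k)"
      if h: "i \<in> B" "j \<in> B" "i \<noteq> j" "k \<in> B" "l \<in> B" "k \<noteq> l" for i j k l
    proof -
      let ?Q = "\<lambda>X. s i j \<in> X \<and> s k l \<in> X \<and> t i j \<notin> X \<and> t k l \<notin> X"
      have "(\<exists>X. X \<subseteq> B \<and> card X = m \<and> i \<in> X \<and> k \<in> X \<and> j \<notin> X \<and> l \<notin> X) \<longleftrightarrow>
            (\<exists>X. X \<subseteq> B \<and> card X = m \<and> ?Q (\<sigma> X))"
        using sigma[of i j] sigma[of k l] h by metis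
      also have "\<dots> \<longleftrightarrow> (\<exists>Y \<in> \<sigma> ` {X. X \<subseteq> B \<and> card X = m}. ?Q Y)" by auto
      also have "\<dots> \<longleftrightarrow> (\<exists>Y. Y \<subseteq> B' \<and> card Y = m \<and> ?Q Y)" unfolding \<sigma> by auto
      finally show ?thesis
        using subset_separating_two_pairs[of m B i j k l] st[of i j] st[of k l] h fin m
          subset_separating_two_pairs[of m B' "s i j" "t i j" "s k l" "t k l"] by auto
    qed
  qed
  \<comment> \<open>A separating pair needs one point inside \<open>X\<close> and one outside; the
    bounds on \<open>m\<close> provide both.\<close>
  have out: "\<exists>j\<in>B. j \<notin> X" if "X \<subseteq> B" "card X = m" for X
    using that m fin by (metis add_2_eq_Suc' not_less_eq_eq le_SucI le_refl subsetI subset_antisym)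
  have inn: "\<exists>i\<in>B. i \<in> X" if "X \<subseteq> B" "card X = m" for X
    using that m by (metis card.empty ex_in_conv not_numeral_le_zero subsetD)
  have size: "\<sigma> X \<subseteq> B' \<and> card (\<sigma> X) = m" if "X \<subseteq> B" "card X = m" for X
    using \<sigma> that by blast
  obtain \<tau> where \<tau>: "(\<forall>i\<in>B. \<forall>j\<in>B. i \<noteq> j \<longrightarrow> s i j = \<tau> i \<and> t i j = \<tau> j) \<or>
       (\<forall>i\<in>B. \<forall>j\<in>B. i \<noteq> j \<longrightarrow> s i j = \<tau> j \<and> t i j = \<tau> i)" using induced by blast
  have inj: "inj_on \<tau> B" using \<tau> st by (intro inj_onI) metis
  have "\<tau> i \<in> B'" if i: "i \<in> B" for i
  proof -
    obtain j where "j \<in> B" "j \<noteq> i" using three_others[OF i] by auto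
    then show ?thesis using \<tau> st[of i j] i by auto
  qed
  then have "\<tau> ` B \<subseteq> B'" by blast
  then have bij: "bij_betw \<tau> B B'"
    using inj fin card_image[OF inj] card_subset_eq[of B' "\<tau> ` B"] unfolding bij_betw_def by simp
  from \<tau> show ?thesis
  proof
    assume h: "\<forall>i\<in>B. \<forall>j\<in>B. i \<noteq> j \<longrightarrow> s i j = \<tau> i \<and> t i j = \<tau> j"
    have "\<sigma> X = \<tau> ` X" if X: "X \<subseteq> B" "card X = m" for X
    proof -
      obtain j where j: "j \<in> B" "j \<notin> X" using out X by blast
      have "\<tau> i \<in> \<sigma> X" if "i \<in> X" for i
      proof -
        have "i \<in> B" "i \<noteq> j" using that j X by auto
        then show ?thesis using sigma[of i j X] h j X that by auto
      qed
      then have "\<tau> ` X \<subseteq> \<sigma> X" by blast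
      moreover have "card (\<tau> ` X) = m" using X inj by (metis card_image inj_on_subset)
      ultimately show ?thesis using size[OF X] fin by (metis card_subset_eq finite_subset)
    qed
    then show ?thesis using bij by blast
  next
    assume h: "\<forall>i\<in>B. \<forall>j\<in>B. i \<noteq> j \<longrightarrow> s i j = \<tau> j \<and> t i j = \<tau> i"
    have eq: "\<sigma> X = B' - \<tau> ` X" if X: "X \<subseteq> B" "card X = m" for X
    proof
      obtain j where j: "j \<in> B" "j \<notin> X" using out X by blast
      have "\<tau> i \<notin> \<sigma> X" if "i \<in> X" for i
      proof -
        have "i \<in> B" "i \<noteq> j" using that j X by auto
        then show ?thesis using sigma[of i j X] h j X that by auto
      qed
      then show "\<sigma> X \<subseteq> B' - \<tau> ` X" using size[OF X] by blast
      obtain i where i: "i \<in> B" "i \<in> X" using inn X by blast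
      show "B' - \<tau> ` X \<subseteq> \<sigma> X"
      proof
        fix b assume b: "b \<in> B' - \<tau> ` X"
        then obtain j where "j \<in> B" "b = \<tau> j" using bij unfolding bij_betw_def by blast
        moreover have "j \<notin> X" using b calculation by blast
        ultimately show "b \<in> \<sigma> X" using sigma[of i j X] h i X by auto
      qed
    qed
    \<comment> \<open>Any one \<open>X\<close> fixes the size: \<open>\<sigma> X\<close> has
      \<open>m\<close> points, the complement of the image of \<open>X\<close> has
      \<open>card B - m\<close>.\<close>
    obtain X where X: "X \<subseteq> B" "card X = m" using m fin by (metis add_leD1 obtain_subset_with_card_n)
    have "\<tau> ` X \<subseteq> B'" using X bij unfolding bij_betw_def by blast
    moreover have "card (\<tau> ` X) = m" using X inj by (metis card_image inj_on_subset)
    ultimately have "card (B' - \<tau> ` X) = card B - m" using fin by (metis card_Diff_subset finite_subset)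
    then have "card B = 2 * m" using eq[OF X] size[OF X] m by simp
    then show ?thesis using bij eq by blast
  qed
qed

section \<open>Maps between spaces\<close>

text \<open>\<open>m\<close> counts spanning points, so \<open>m = k + 1\<close> and the bounds say
  \<open>0 < k < n - 1\<close>. Base subsets enter only in an extension, so that this locale can be
  instantiated again with the dual as target.\<close>

locale space_pair = src: exchange_space P L n + tgt: exchange_space P' L' n
  for P :: "'a set" and L :: "'a set set" and P' :: "'b set" and L' :: "'b set set" and n :: nat +
  fixes m :: nat and f :: "'a set \<Rightarrow> 'b set"
  assumes m: "2 \<le> m" "m + 2 \<le> Suc n"
begin

definition direct :: "'a set \<Rightarrow> bool" where
  "direct B \<longleftrightarrow> (\<exists>\<tau>. inj_on \<tau> B \<and> tgt.base (\<tau> ` B) \<and>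
     (\<forall>X. X \<subseteq> B \<longrightarrow> card X = m \<longrightarrow> f (src.cl X) = tgt.cl (\<tau> ` X)))"

definition opposite :: "'a set \<Rightarrow> bool" where
  "opposite B \<longleftrightarrow> (\<exists>\<tau>. inj_on \<tau> B \<and> tgt.base (\<tau> ` B) \<and>
     (\<forall>X. X \<subseteq> B \<longrightarrow> card X = m \<longrightarrow> f (src.cl X) = tgt.cl (\<tau> ` B - \<tau> ` X)))"

text \<open>Take \<open>m + 1\<close> common points \<open>D\<close>. For each
  \<open>m\<close>-subset of \<open>D\<close> the image contains \<open>\<upsilon> y\<close> by the
  opposite rule, as \<open>y\<close> is outside the subset, and is spanned by the
  \<open>\<tau>\<close>-image of the subset by the direct rule. These subsets have empty
  intersection, so the support of \<open>\<upsilon> y\<close> would be empty.\<close>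

lemma direct_not_opposite:
  assumes A: "x \<notin> A" "y \<notin> A" "src.base (insert x A)" "src.base (insert y A)"
    and dir: "direct (insert x A)" and opp: "opposite (insert y A)"
  shows False
proof -
  obtain \<tau> where \<tau>: "inj_on \<tau> (insert x A)" "tgt.base (\<tau> ` insert x A)"
     "\<And>X. X \<subseteq> insert x A \<Longrightarrow> card X = m \<Longrightarrow> f (src.cl X) = tgt.cl (\<tau> ` X)"
    using dir unfolding direct_def by blast
  obtain \<upsilon> where \<upsilon>: "inj_on \<upsilon> (insert y A)" "tgt.base (\<upsilon> ` insert y A)"
     "\<And>X. X \<subseteq> insert y A \<Longrightarrow> card X = m \<Longrightarrow> f (src.cl X) = tgt.cl (\<upsilon> ` insert y A - \<upsilon> ` X)"
    using opp unfolding opposite_def by blast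
  have finA: "finite A" using src.baseD(1)[OF A(3)] by simp
  have cardA: "card A = n" using src.base_card[OF A(3)] A(1) finA by simp
  obtain D where D: "D \<subseteq> A" "card D = Suc m"
    using obtain_subset_with_card_n[of "Suc m" A] m cardA by auto
  have finD: "finite D" using D finA finite_subset by blast
  let ?b = "\<upsilon> y"
  have bP: "?b \<in> P'" using tgt.baseD(2)[OF \<upsilon>(2)] by blast
  obtain C where C: "C \<subseteq> \<tau> ` insert x A" "\<forall>X\<subseteq>\<tau> ` insert x A. ?b \<in> tgt.cl X \<longleftrightarrow> C \<subseteq> X"
    using tgt.base_support[OF \<tau>(2) bP] by blast
  have CD: "C \<subseteq> \<tau> ` (D - {d})" if "d \<in> D" for d
  proof -
    have c: "card (D - {d}) = m" using D(2) that finD by simp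
    have s: "D - {d} \<subseteq> insert x A" "D - {d} \<subseteq> insert y A" using D by auto
    have "?b \<notin> \<upsilon> ` (D - {d})" using \<upsilon>(1) D(1) A(2) unfolding inj_on_def by blast
    then have "?b \<in> \<upsilon> ` insert y A - \<upsilon> ` (D - {d})" by simp
    then have "?b \<in> f (src.cl (D - {d}))" using \<upsilon>(3)[OF s(2) c] span_superset by metis
    then have "?b \<in> tgt.cl (\<tau> ` (D - {d}))" using \<tau>(3)[OF s(1) c] by simp
    then show ?thesis using C(2) s(1) by (meson image_mono)
  qed
  have "C = {}"
  proof (rule ccontr)
    assume "C \<noteq> {}"
    then obtain c where c: "c \<in> C" by blast
    obtain d0 where "d0 \<in> D" using D(2) by fastforce
    then obtain e where e: "e \<in> D" "c = \<tau> e" using CD c by blast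
    then have "\<tau> e \<in> \<tau> ` (D - {e})" using CD c by blast
    then show False using \<tau>(1) D(1) e(1) unfolding inj_on_def by blast
  qed
  then have "?b \<in> tgt.cl {}" using C(2) by blast
  then show False using tgt.span_empty by simp
qed

lemma type_constant:
  assumes types: "\<And>B. src.base B \<Longrightarrow> direct B \<or> opposite B"
  shows "(\<forall>B. src.base B \<longrightarrow> direct B) \<or> (\<forall>B. src.base B \<longrightarrow> opposite B)"
proof (cases "\<exists>B0. src.base B0 \<and> direct B0")
  case True
  then obtain B0 where B0: "src.base B0" "direct B0" by blast
  have "direct B" if B: "src.base B" for B
  proof (rule src.base_connected[of B0 B "{}" direct])
    fix A x y
    assume "x \<notin> A" "y \<notin> A" "src.base (insert x A)" "src.base (insert y A)" "direct (insert x A)"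
    then show "direct (insert y A)" using direct_not_opposite types by metis
  qed (use B0 B in auto)
  then show ?thesis by blast
next
  case False
  then show ?thesis using types by blast
qed

text \<open>The bijections belonging to single bases are glued to one map \<open>g\<close>; supports
  over a base show both that the gluing is consistent and that \<open>g\<close> preserves
  collinearity.\<close>

lemma strong_embedding_of_direct:
  assumes dir: "\<And>B. src.base B \<Longrightarrow> direct B" and k: "m = Suc k"
  shows "\<exists>g. strong_embedding P L P' L' g \<and> (\<forall>S\<in>Gr P L k. f S = tgt.cl (g ` S))"
proof -
  have "\<forall>B. \<exists>\<tau>. src.base B \<longrightarrow> inj_on \<tau> B \<and> tgt.base (\<tau> ` B) \<and>
     (\<forall>X. X \<subseteq> B \<longrightarrow> card X = m \<longrightarrow> f (src.cl X) = tgt.cl (\<tau> ` X))"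
    using dir unfolding direct_def by blast
  from choice[OF this] obtain \<tau> where "\<forall>B. src.base B \<longrightarrow> inj_on (\<tau> B) B \<and> tgt.base (\<tau> B ` B) \<and>
     (\<forall>X. X \<subseteq> B \<longrightarrow> card X = m \<longrightarrow> f (src.cl X) = tgt.cl (\<tau> B ` X))" by blast
  then have \<tau>: "\<And>B. src.base B \<Longrightarrow> inj_on (\<tau> B) B" "\<And>B. src.base B \<Longrightarrow> tgt.base (\<tau> B ` B)"
     "\<And>B X. src.base B \<Longrightarrow> X \<subseteq> B \<Longrightarrow> card X = m \<Longrightarrow> f (src.cl X) = tgt.cl (\<tau> B ` X)"
    by auto
  \<comment> \<open>The support of \<open>?\<tau> p\<close> over the second base lies in the
    \<open>?\<upsilon>\<close>-image of every \<open>m\<close>-subset of \<open>A\<close> through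
    \<open>p\<close>. As \<open>m < card A\<close>, these subsets meet in \<open>p\<close>
    alone.\<close>
  have step: "\<tau> (insert x A) p = \<tau> (insert y A) p"
    if A: "x \<notin> A" "y \<notin> A" "src.base (insert x A)" "src.base (insert y A)" "p \<in> A" for A x y p
  proof -
    let ?\<tau> = "\<tau> (insert x A)" and ?\<upsilon> = "\<tau> (insert y A)"
    have finA: "finite A" using src.baseD(1)[OF A(3)] by simp
    have cardA: "card A = n" using src.base_card[OF A(3)] A(1) finA by simp
    have bP: "?\<tau> p \<in> P'" using tgt.baseD(2)[OF \<tau>(2)[OF A(3)]] A(5) by blast
    obtain C where C: "C \<subseteq> ?\<upsilon> ` insert y A" "\<forall>X\<subseteq>?\<upsilon> ` insert y A. ?\<tau> p \<in> tgt.cl X \<longleftrightarrow> C \<subseteq> X"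
      using tgt.base_support[OF \<tau>(2)[OF A(4)] bP] by blast
    have CX: "C \<subseteq> ?\<upsilon> ` X" if X: "X \<subseteq> A" "card X = m" "p \<in> X" for X
    proof -
      have s: "X \<subseteq> insert x A" "X \<subseteq> insert y A" using X by auto
      have "?\<tau> p \<in> tgt.cl (?\<tau> ` X)" using X(3) by (simp add: span_superset)
      then have "?\<tau> p \<in> tgt.cl (?\<upsilon> ` X)" using \<tau>(3)[OF A(3) s(1) X(2)] \<tau>(3)[OF A(4) s(2) X(2)] by simp
      then show ?thesis using C(2) s(2) by (meson image_mono)
    qed
    have "C \<subseteq> {?\<upsilon> p}"
    proof
      fix c assume c: "c \<in> C"
      obtain X0 where "{p} \<subseteq> X0 \<and> X0 \<subseteq> A \<and> card X0 = m \<and> X0 \<inter> {} = {}"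
        using subset_of_card_between[of A "{p}" "{}" m] A(5) finA cardA m by auto
      then obtain q where q: "q \<in> A" "c = ?\<upsilon> q" using CX[of X0] c by blast
      show "c \<in> {?\<upsilon> p}"
      proof (rule ccontr)
        assume "c \<notin> {?\<upsilon> p}"
        then have "q \<noteq> p" using q by blast
        then obtain X where X: "{p} \<subseteq> X \<and> X \<subseteq> A \<and> card X = m \<and> X \<inter> {q} = {}"
          using subset_of_card_between[of A "{p}" "{q}" m] A(5) finA cardA m q by auto
        then have "?\<upsilon> q \<in> ?\<upsilon> ` X" using CX[of X] c q by blast
        then have "q \<in> X" using X q \<tau>(1)[OF A(4)] unfolding inj_on_def by blast
        then show False using X by blast
      qed
    qed
    then have "?\<tau> p \<in> tgt.cl {?\<upsilon> p}" using C(2) A(5) by blast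
    moreover have "?\<upsilon> p \<in> P'" using tgt.baseD(2)[OF \<tau>(2)[OF A(4)]] A(5) by blast
    ultimately show ?thesis using tgt.span_singleton by simp
  qed
  \<comment> \<open>Chains of bases that all contain \<open>p\<close> carry the value at
    \<open>p\<close> from one base to any other.\<close>
  have agree: "\<tau> B p = \<tau> B0 p" if B: "src.base B0" "src.base B" "p \<in> B0" "p \<in> B" for B B0 p
  proof (rule src.base_connected[of B0 B "{p}" "\<lambda>B. \<tau> B p = \<tau> B0 p"])
    fix A x y
    assume "{p} \<subseteq> A" "x \<notin> A" "y \<notin> A" "src.base (insert x A)" "src.base (insert y A)"
      "\<tau> (insert x A) p = \<tau> B0 p"
    then show "\<tau> (insert y A) p = \<tau> B0 p" using step[of x A y p] by simp
  qed (use B in auto)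
  define g where "g p = \<tau> (SOME B. src.base B \<and> p \<in> B) p" for p
  have g: "g p = \<tau> B p" if "src.base B" "p \<in> B" for B p
  proof -
    have "src.base (SOME B. src.base B \<and> p \<in> B) \<and> p \<in> (SOME B. src.base B \<and> p \<in> B)"
      using that by (intro someI[of "\<lambda>B. src.base B \<and> p \<in> B"]) blast
    then show ?thesis unfolding g_def using agree that by blast
  qed
  have gX: "g ` X = \<tau> B ` X" if "src.base B" "X \<subseteq> B" for B X
    using g[OF that(1)] that(2) by (intro image_cong) auto
  have fX: "f (src.cl X) = tgt.cl (g ` X)" if "src.base B" "X \<subseteq> B" "card X = m" for B X
    using gX[OF that(1,2)] \<tau>(3)[OF that] by simp
  have inj: "inj_on g P"
  proof (rule inj_onI)
    fix x y assume h: "x \<in> P" "y \<in> P" "g x = g y"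
    then obtain B where B: "src.base B" "x \<in> B" "y \<in> B" using src.two_points_base by blast
    then show "x = y" using g[OF B(1)] h \<tau>(1)[OF B(1)] unfolding inj_on_def by simp
  qed
  have gP: "g ` P \<subseteq> P'"
  proof
    fix b assume "b \<in> g ` P"
    then obtain x where x: "x \<in> P" "b = g x" by blast
    then obtain B where B: "src.base B" "x \<in> B" using src.two_points_base by blast
    then show "b \<in> P'" using g[OF B] x tgt.baseD(2)[OF \<tau>(2)[OF B(1)]] by blast
  qed
  have ind: "tgt.indep (g ` X)" if X: "src.indep X" for X
  proof -
    obtain B where B: "src.base B" "X \<subseteq> B" using src.base_extend[OF X] by blast
    then have "g ` X \<subseteq> \<tau> B ` B" using gX[OF B] by blast
    then show ?thesis using tgt.indep_subset tgt.baseD(3)[OF \<tau>(2)[OF B(1)]] by blast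
  qed
  \<comment> \<open>Every point of \<open>S\<close> belongs to a base of \<open>S\<close>, which
    extends to a base of the space, so \<open>g\<close> sends it into \<open>f S\<close>.
    Conversely, the image of a single base of \<open>S\<close> already generates
    \<open>f S\<close>.\<close>
  have fS: "f S = tgt.cl (g ` S)" if S: "S \<in> Gr P L k" for S
  proof -
    obtain I where I: "src.indep I" "card I = m" "src.cl I = S"
      using S k unfolding Gr_def src.has_dim_iff by auto
    have IP: "I \<subseteq> P" using I(1) unfolding src.indep_def by blast
    have SP: "S \<subseteq> P" using src.span_closed[OF IP] I(3) by simp
    have "g x \<in> f S" if x: "x \<in> S" for x
    proof -
      have "src.indep {x}"
        using src.indep_insert[OF src.indep_empty, of x] x SP src.span_empty by auto
      then obtain J where J: "{x} \<subseteq> J" "J \<subseteq> S" "src.indep J" "src.cl J = src.cl S"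
        using src.indep_extend[of "{x}" S] x SP by auto
      have cS: "src.cl S = S" using src.span_subspace[OF src.subspace_span[OF IP]] I(3) by simp
      have cJ: "card J = m" using src.indep_card_eq[OF J(3) I(1)] I J(4) cS by simp
      obtain B where B: "src.base B" "J \<subseteq> B" using src.base_extend[OF J(3)] by blast
      have "f S = tgt.cl (g ` J)" using fX[OF B cJ] J(4) cS by simp
      then show ?thesis using J(1) by (simp add: span_superset)
    qed
    then have "g ` S \<subseteq> f S" by blast
    moreover obtain B where B: "src.base B" "I \<subseteq> B" using src.base_extend[OF I(1)] by blast
    moreover have "f S = tgt.cl (g ` I)" using fX[OF B I(2)] I(3) by simp
    moreover have "g ` I \<subseteq> g ` S" using I(3) subset_span[of I P L] by blast
    ultimately show ?thesis by (metis span_absorb)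
  qed
  \<comment> \<open>The line is recovered from the \<open>k\<close>-dimensional subspaces through
    it: the support of \<open>g z\<close> lies in the image of each \<open>m\<close>-subset of
    \<open>B\<close> through \<open>x\<close> and \<open>y\<close>, and these subsets have no
    further point in common.\<close>
  have col: "g z \<in> tgt.cl {g x, g y}" if h: "x \<in> P" "y \<in> P" "z \<in> P" "z \<in> src.cl {x, y}" for x y z
  proof -
    obtain B where B: "src.base B" "x \<in> B" "y \<in> B" using src.two_points_base h by blast
    have zP: "g z \<in> P'" using gP h by blast
    have gB: "tgt.base (g ` B)" using \<tau>(2)[OF B(1)] gX[OF B(1)] by simp
    obtain C where C: "C \<subseteq> g ` B" "\<forall>X\<subseteq>g ` B. g z \<in> tgt.cl X \<longleftrightarrow> C \<subseteq> X"
      using tgt.base_support[OF gB zP] by blast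
    have CX: "C \<subseteq> g ` X" if X: "X \<subseteq> B" "card X = m" "x \<in> X" "y \<in> X" for X
    proof -
      have iX: "src.indep X" using src.indep_subset[OF src.baseD(3)[OF B(1)] X(1)] .
      then have "src.cl X \<in> Gr P L k" using X(2) k unfolding Gr_def src.has_dim_iff by blast
      then have "f (src.cl X) = tgt.cl (g ` src.cl X)" by (rule fS)
      moreover have "z \<in> src.cl X" using h(4) span_mono[of "{x, y}" X P L] X by blast
      ultimately have "g z \<in> f (src.cl X)" by (simp add: span_superset)
      then have "g z \<in> tgt.cl (g ` X)" using fX[OF B(1) X(1,2)] by simp
      then show ?thesis using C(2) X(1) by (meson image_mono)
    qed
    have "C \<subseteq> {g x, g y}"
    proof
      fix c assume c: "c \<in> C"
      then obtain q where q: "q \<in> B" "c = g q" using C(1) by blast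
      show "c \<in> {g x, g y}"
      proof (rule ccontr)
        assume "c \<notin> {g x, g y}"
        then have "q \<noteq> x" "q \<noteq> y" using q by auto
        moreover have "card {x, y} \<le> m" using m by (auto simp: card_insert_if)
        ultimately obtain X where X: "{x, y} \<subseteq> X \<and> X \<subseteq> B \<and> card X = m \<and> X \<inter> {q} = {}"
          using subset_of_card_between[of B "{x, y}" "{q}" m] B q src.base_card[OF B(1)] src.baseD(1)[OF B(1)] m
          by auto
        then have "g q \<in> g ` X" using CX[of X] c q by blast
        moreover have "q \<in> P" "X \<subseteq> P" using X q src.baseD(2)[OF B(1)] by auto
        ultimately have "q \<in> X" using inj_on_image_mem_iff[OF inj] by blast
        then show False using X by blast
      qed
    qed
    moreover have "{g x, g y} \<subseteq> g ` B" using B by blast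
    ultimately show ?thesis using C(2) by blast
  qed
  have other: "\<exists>w\<in>P. w \<noteq> x" for x
  proof -
    obtain B where B: "src.base B" using src.base_extend[OF src.indep_empty] by blast
    have "\<not> B \<subseteq> {x}" using src.base_card[OF B] m card_mono[of "{x}" B] by auto
    then show ?thesis using src.baseD(2)[OF B] by blast
  qed
  have "strong_embedding P L P' L' g"
    unfolding strong_embedding_def
  proof (intro conjI ballI allI impI)
    show "inj_on g P" "g ` P \<subseteq> P'" by fact+
    show "independent P' L' (g ` X)" if "independent P L X" for X
      using ind[of X] that src.independent_iff tgt.independent_iff by simp
    show "collinear L' {g x, g y, g z}" if h: "x \<in> P" "y \<in> P" "z \<in> P" "collinear L {x, y, z}" for x y z
    proof (cases "x = y")
      case True
      obtain w where "w \<in> P" "w \<noteq> x" using other by blast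
      then have "g w \<in> P'" "g w \<noteq> g x" using gP inj h(1) unfolding inj_on_def by auto
      then show ?thesis using tgt.collinear_degenerate[of "g x" "g y" "g z" "g w"] True gP h by blast
    next
      case False
      then have "g x \<noteq> g y" using inj h unfolding inj_on_def by blast
      moreover have "z \<in> src.cl {x, y}" using src.collinear_iff_span h False by blast
      ultimately show ?thesis using tgt.collinear_iff_span[of "g x" "g y" "g z"] col h gP by blast
    qed
    show "\<not> collinear L' {g x, g y, g z}"
      if h: "x \<in> P" "y \<in> P" "z \<in> P" "\<not> collinear L {x, y, z}" for x y z
    proof -
      obtain w where "w \<in> P" "w \<noteq> x" using other by blast
      then have ne: "x \<noteq> y" "x \<noteq> z" "y \<noteq> z" using src.collinear_degenerate h by metis+
      then have "src.indep {x, y, z}" using src.noncollinear_indep src.collinear_iff_span h by blast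
      then have "tgt.indep {g x, g y, g z}" using ind[of "{x, y, z}"] by simp
      moreover have "{g x, g y, g z} - {g z} = {g x, g y}" using ne h inj unfolding inj_on_def by blast
      ultimately have "g z \<notin> tgt.cl {g x, g y}" unfolding tgt.indep_def by fastforce
      moreover have "g x \<noteq> g y" using ne h inj unfolding inj_on_def by blast
      ultimately show ?thesis using tgt.collinear_iff_span[of "g x" "g y" "g z"] h gP by blast
    qed
  qed
  then show ?thesis using fS by blast
qed

end

text \<open>\<open>thick\<close> comes from lines having three points and concerns the source only;
  \<open>base_map\<close> restates the hypothesis on base subsets through
  \<open>subsets_span\<close>.\<close>

locale base_subset_map = space_pair +
  assumes thick: "\<lbrakk>x \<in> P; y \<in> P; x \<noteq> y\<rbrakk> \<Longrightarrow> \<exists>p\<in>src.cl {x, y}. p \<noteq> x \<and> p \<noteq> y"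
    and base_map: "src.base B \<Longrightarrow> \<exists>B'. tgt.base B' \<and> f ` src.subsets_span m B = tgt.subsets_span m B'"
begin

text \<open>Injectivity on a base subset comes for free: it is mapped onto a base subset with the
  same finite number of elements.\<close>

lemma sigma_exists:
  assumes B: "src.base B"
  shows "\<exists>B' \<sigma>. tgt.base B' \<and> bij_betw \<sigma> {X. X \<subseteq> B \<and> card X = m} {X. X \<subseteq> B' \<and> card X = m} \<and>
    (\<forall>X. X \<subseteq> B \<longrightarrow> card X = m \<longrightarrow> f (src.cl X) = tgt.cl (\<sigma> X))"
proof -
  obtain B' where B': "tgt.base B'" and im: "f ` src.subsets_span m B = tgt.subsets_span m B'"
    using base_map[OF B] by blast
  let ?M = "{X. X \<subseteq> B \<and> card X = m}" and ?M' = "{X. X \<subseteq> B' \<and> card X = m}"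
  have "\<forall>X\<in>?M. \<exists>Y. Y \<in> ?M' \<and> f (src.cl X) = tgt.cl Y"
  proof
    fix X assume "X \<in> ?M"
    then have "f (src.cl X) \<in> tgt.subsets_span m B'" using im unfolding src.subsets_span_def by blast
    then show "\<exists>Y. Y \<in> ?M' \<and> f (src.cl X) = tgt.cl Y" unfolding tgt.subsets_span_def by blast
  qed
  from bchoice[OF this] obtain \<sigma> where \<sigma>: "\<forall>X\<in>?M. \<sigma> X \<in> ?M' \<and> f (src.cl X) = tgt.cl (\<sigma> X)" by blast
  have "\<sigma> ` ?M = ?M'"
  proof
    show "\<sigma> ` ?M \<subseteq> ?M'" using \<sigma> by blast
    show "?M' \<subseteq> \<sigma> ` ?M"
    proof
      fix Y assume Y: "Y \<in> ?M'"
      then have "tgt.cl Y \<in> f ` src.subsets_span m B" unfolding im tgt.subsets_span_def by blast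
      then obtain X where X: "X \<in> ?M" "f (src.cl X) = tgt.cl Y"
        unfolding src.subsets_span_def by auto
      then have "\<sigma> X = Y" using tgt.base_span_inj[OF B', of "\<sigma> X" Y] \<sigma> Y by auto
      then show "Y \<in> \<sigma> ` ?M" using X by blast
    qed
  qed
  moreover have "card ?M = card ?M'"
    using n_subsets[of B m] n_subsets[of B' m] src.baseD(1)[OF B] tgt.baseD(1)[OF B']
      src.base_card[OF B] tgt.base_card[OF B'] by simp
  moreover have "finite ?M" using src.baseD(1)[OF B] by simp
  ultimately have "bij_betw \<sigma> ?M ?M'" unfolding bij_betw_def by (simp add: eq_card_imp_inj_on)
  then show ?thesis using B' \<sigma> by blast
qed

lemma base_span_image_inj:
  assumes B: "src.base B" and X: "X \<subseteq> B" "card X = m" and Y: "Y \<subseteq> B" "card Y = m"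
    and eq: "f (src.cl X) = f (src.cl Y)"
  shows "X = Y"
proof -
  obtain B' \<sigma> where \<sigma>: "tgt.base B'" "bij_betw \<sigma> {X. X \<subseteq> B \<and> card X = m} {X. X \<subseteq> B' \<and> card X = m}"
    "\<forall>X. X \<subseteq> B \<longrightarrow> card X = m \<longrightarrow> f (src.cl X) = tgt.cl (\<sigma> X)"
    using sigma_exists[OF B] by blast
  have "\<sigma> X \<subseteq> B'" "\<sigma> Y \<subseteq> B'" using \<sigma>(2) X Y unfolding bij_betw_def by blast+
  moreover have "tgt.cl (\<sigma> X) = tgt.cl (\<sigma> Y)" using \<sigma>(3) X Y eq by metis
  ultimately have "\<sigma> X = \<sigma> Y" using tgt.base_span_inj[OF \<sigma>(1)] by blast
  then show ?thesis using \<sigma>(2) X Y unfolding bij_betw_def inj_on_def by blast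
qed

text \<open>Moving \<open>i\<close> to a third point \<open>p\<close> of the line \<open>ij\<close> gives a second base whose base subset contains
  exactly the elements that do not separate \<open>i\<close> from \<open>j\<close>; the images of both base subsets
  are again distinct, so these elements map to elements not separating some \<open>i'\<close> from \<open>j'\<close>, and counting gives
  the converse.\<close>

lemma separating_pairs:
  assumes B: "src.base B" and B': "tgt.base B'"
    and \<sigma>: "bij_betw \<sigma> {X. X \<subseteq> B \<and> card X = m} {X. X \<subseteq> B' \<and> card X = m}"
      "\<And>X. X \<subseteq> B \<Longrightarrow> card X = m \<Longrightarrow> f (src.cl X) = tgt.cl (\<sigma> X)"
    and ij: "i \<in> B" "j \<in> B" "i \<noteq> j"
  shows "\<exists>i'\<in>B'. \<exists>j'\<in>B'. i' \<noteq> j' \<and>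
      (\<forall>X. X \<subseteq> B \<longrightarrow> card X = m \<longrightarrow> (i \<in> X \<and> j \<notin> X \<longleftrightarrow> i' \<in> \<sigma> X \<and> j' \<notin> \<sigma> X))"
proof -
  have P: "i \<in> P" "j \<in> P" using ij src.baseD(2)[OF B] by auto
  have fin: "finite X" if "X \<subseteq> B" for X using that src.baseD(1)[OF B] finite_subset by blast
  obtain p where p: "p \<in> src.cl {i, j}" "p \<noteq> i" "p \<noteq> j" using thick[OF P ij(3)] by blast
  have p': "p \<in> src.cl {j, i}" using p(1) by (simp add: insert_commute)
  define B2 where "B2 = insert p (B - {i})"
  have B2: "src.base B2" and pB: "p \<notin> B"
    using src.line_third_point_base[OF B ij p] unfolding B2_def by auto
  \<comment> \<open>A second auxiliary base, with \<open>p\<close> in place of \<open>j\<close>, for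
    those \<open>X\<close> that contain \<open>i\<close> but not \<open>j\<close>.\<close>
  have B3: "src.base (insert p (B - {j}))"
    using src.line_third_point_base(1)[OF B ij(2,1) not_sym[OF ij(3)] p' p(3,2)] .
  obtain B2' \<sigma>2 where \<sigma>2: "tgt.base B2'" "bij_betw \<sigma>2 {X. X \<subseteq> B2 \<and> card X = m} {X. X \<subseteq> B2' \<and> card X = m}"
    "\<forall>X. X \<subseteq> B2 \<longrightarrow> card X = m \<longrightarrow> f (src.cl X) = tgt.cl (\<sigma>2 X)"
    using sigma_exists[OF B2] by blast
  \<comment> \<open>The subset of \<open>B2\<close> with the same span as \<open>X\<close>, provided
    that \<open>X\<close> does not contain \<open>i\<close> without \<open>j\<close>.\<close>
  define mv where "mv X = (if i \<in> X then insert p (X - {i}) else X)" for X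
  have mv: "mv X \<subseteq> B2 \<and> card (mv X) = m \<and> src.cl X = src.cl (mv X)"
    if X: "X \<subseteq> B" "card X = m" "\<not> (i \<in> X \<and> j \<notin> X)" for X
  proof (cases "i \<in> X")
    case True
    have "p \<notin> X - {i}" using pB X by blast
    then have "card (insert p (X - {i})) = m" using fin[OF X(1)] X(2) True by (metis card.remove card_insert_disjoint finite_Diff)
    moreover have "src.cl X = src.cl (insert p (X - {i}))"
      using src.line_third_point_span[OF P p(1,3) True _ ij(3)] X(3) True by blast
    ultimately show ?thesis using True X unfolding mv_def B2_def by auto
  next
    case False
    then show ?thesis using X unfolding mv_def B2_def by auto
  qed
  \<comment> \<open>Let \<open>?S\<close> consist of \<open>p\<close> and points of \<open>B\<close>
    other than \<open>i\<close>, \<open>j\<close>. If the image bases agreed, \<open>f\<close> would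
    give the spans of \<open>?S\<close> and of some \<open>X\<close> in \<open>B\<close> the same
    value. Either \<open>X\<close> itself or \<open>mv X\<close> shares a base with
    \<open>?S\<close>, so injectivity there makes them equal, which comparing points
    refutes.\<close>
  have "B' \<noteq> B2'"
  proof
    assume eq: "B' = B2'"
    have "m - 1 \<le> card (B - {i, j})" using src.base_card[OF B] ij m by (simp add: card_Diff_subset)
    then obtain Y where Y: "Y \<subseteq> B - {i, j}" "card Y = m - 1" by (meson obtain_subset_with_card_n)
    have finY: "finite Y" using Y fin by blast
    let ?S = "insert p Y"
    have "p \<notin> Y" using Y pB by blast
    then have S: "?S \<subseteq> B2" "card ?S = m" using Y finY m unfolding B2_def by auto
    then have "\<sigma>2 ?S \<in> {X. X \<subseteq> B' \<and> card X = m}" using \<sigma>2(2) unfolding bij_betw_def eq by blast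
    then obtain X where X: "X \<subseteq> B" "card X = m" "\<sigma> X = \<sigma>2 ?S" using \<sigma>(1) unfolding bij_betw_def
      by (smt (verit) imageE mem_Collect_eq)
    have fe: "f (src.cl X) = f (src.cl ?S)" using \<sigma>(2)[OF X(1,2)] \<sigma>2(3) S X(3) by simp
    show False
    proof (cases "i \<in> X \<and> j \<notin> X")
      case True
      then have "X \<subseteq> insert p (B - {j})" "?S \<subseteq> insert p (B - {j})" using X Y by auto
      then have "X = ?S" using base_span_image_inj[OF B3] X S fe by blast
      then show False using pB X by blast
    next
      case False
      then have "mv X = ?S" using mv[OF X(1,2) False] base_span_image_inj[OF B2, of "mv X" ?S] S fe by metis
      then have "i \<in> X" using pB X unfolding mv_def by (metis insertI1 subsetD)
      then have "j \<in> mv X" using False ij unfolding mv_def by auto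
      then show False using \<open>mv X = ?S\<close> Y p by auto
    qed
  qed
  then obtain i' j' where ij': "i' \<in> B'" "j' \<in> B'" "i' \<noteq> j'"
    "\<forall>X\<subseteq>B'. (\<exists>Y\<subseteq>B2'. tgt.cl X = tgt.cl Y) \<longrightarrow> i' \<in> X \<longrightarrow> j' \<in> X"
    using tgt.distinct_bases_common[OF B' \<sigma>2(1)] by blast
  let ?U = "{X. X \<subseteq> B \<and> card X = m \<and> i \<in> X \<and> j \<notin> X}"
  let ?V = "{X. X \<subseteq> B \<and> card X = m \<and> i' \<in> \<sigma> X \<and> j' \<notin> \<sigma> X}"
  have "?V \<subseteq> ?U"
  proof (rule subsetI, rule ccontr)
    fix X assume X: "X \<in> ?V" and nX: "X \<notin> ?U"
    then have ns: "\<not> (i \<in> X \<and> j \<notin> X)" by blast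
    have "tgt.cl (\<sigma> X) = tgt.cl (\<sigma>2 (mv X))" using mv[OF _ _ ns] X \<sigma>(2)[of X] \<sigma>2(3) by auto
    moreover have "\<sigma>2 (mv X) \<subseteq> B2'" using mv[OF _ _ ns] X \<sigma>2(2) unfolding bij_betw_def by blast
    moreover have "\<sigma> X \<subseteq> B'" using X \<sigma>(1) unfolding bij_betw_def by blast
    ultimately show False using ij'(4) X by blast
  qed
  moreover have "card ?V = card ?U"
  proof -
    have "\<sigma> ` ?V = {Y. Y \<subseteq> B' \<and> card Y = m \<and> i' \<in> Y \<and> j' \<notin> Y}"
    proof -
      have "{Y. Y \<subseteq> B' \<and> card Y = m \<and> i' \<in> Y \<and> j' \<notin> Y} = {Y \<in> \<sigma> ` {X. X \<subseteq> B \<and> card X = m}. i' \<in> Y \<and> j' \<notin> Y}"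
        using \<sigma>(1) unfolding bij_betw_def by auto
      then show ?thesis by auto
    qed
    moreover have "inj_on \<sigma> ?V" using \<sigma>(1) unfolding bij_betw_def by (auto intro: inj_on_subset)
    ultimately have "card ?V = card {Y. Y \<subseteq> B' \<and> card Y = m \<and> i' \<in> Y \<and> j' \<notin> Y}"
      using card_image[of \<sigma> ?V] by simp
    then show ?thesis
      using card_subsets_separating[of B i j m] card_subsets_separating[of B' i' j' m] ij ij' m
        src.baseD(1)[OF B] tgt.baseD(1)[OF B'] src.base_card[OF B] tgt.base_card[OF B'] by simp
  qed
  moreover have "finite ?U" using src.baseD(1)[OF B] by simp
  ultimately have "?V = ?U" by (simp add: card_subset_eq)
  then have "i \<in> X \<and> j \<notin> X \<longleftrightarrow> i' \<in> \<sigma> X \<and> j' \<notin> \<sigma> X" if "X \<subseteq> B" "card X = m" for X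
    using that by blast
  then show ?thesis using ij' by blast
qed

lemma direct_or_opposite:
  assumes B: "src.base B"
  shows "direct B \<or> Suc n = 2 * m \<and> opposite B"
proof -
  obtain B' \<sigma> where \<sigma>: "tgt.base B'" "bij_betw \<sigma> {X. X \<subseteq> B \<and> card X = m} {X. X \<subseteq> B' \<and> card X = m}"
    "\<forall>X. X \<subseteq> B \<longrightarrow> card X = m \<longrightarrow> f (src.cl X) = tgt.cl (\<sigma> X)"
    using sigma_exists[OF B] by blast
  have "\<exists>\<tau>. bij_betw \<tau> B B' \<and>
    ((\<forall>X. X \<subseteq> B \<longrightarrow> card X = m \<longrightarrow> \<sigma> X = \<tau> ` X) \<or>
     card B = 2 * m \<and> (\<forall>X. X \<subseteq> B \<longrightarrow> card X = m \<longrightarrow> \<sigma> X = B' - \<tau> ` X))"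
  proof (rule subset_bijection_induced)
    show "finite B" "finite B'" "card B' = card B" "2 \<le> m" "m + 2 \<le> card B"
      using src.baseD(1)[OF B] tgt.baseD(1)[OF \<sigma>(1)] src.base_card[OF B] tgt.base_card[OF \<sigma>(1)] m by auto
    show "\<sigma> ` {X. X \<subseteq> B \<and> card X = m} = {X. X \<subseteq> B' \<and> card X = m}"
      using \<sigma>(2) unfolding bij_betw_def by blast
    show "\<exists>i'\<in>B'. \<exists>j'\<in>B'. i' \<noteq> j' \<and>
      (\<forall>X. X \<subseteq> B \<longrightarrow> card X = m \<longrightarrow> (i \<in> X \<and> j \<notin> X \<longleftrightarrow> i' \<in> \<sigma> X \<and> j' \<notin> \<sigma> X))"
      if "i \<in> B" "j \<in> B" "i \<noteq> j" for i j
      using separating_pairs[OF B \<sigma>(1,2) _ that] \<sigma>(3) by blast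
  qed
  then obtain \<tau> where \<tau>: "inj_on \<tau> B" "\<tau> ` B = B'" "(\<forall>X. X \<subseteq> B \<longrightarrow> card X = m \<longrightarrow> \<sigma> X = \<tau> ` X) \<or>
     card B = 2 * m \<and> (\<forall>X. X \<subseteq> B \<longrightarrow> card X = m \<longrightarrow> \<sigma> X = B' - \<tau> ` X)"
    unfolding bij_betw_def by blast
  from \<tau>(3) show ?thesis
  proof
    assume "\<forall>X. X \<subseteq> B \<longrightarrow> card X = m \<longrightarrow> \<sigma> X = \<tau> ` X"
    then have "direct B" unfolding direct_def using \<tau>(1,2) \<sigma>(1,3) by (intro exI[of _ \<tau>]) auto
    then show ?thesis ..
  next
    assume h: "card B = 2 * m \<and> (\<forall>X. X \<subseteq> B \<longrightarrow> card X = m \<longrightarrow> \<sigma> X = B' - \<tau> ` X)"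
    then have "opposite B" unfolding opposite_def using \<tau>(1,2) \<sigma>(1,3) by (intro exI[of _ \<tau>]) auto
    then show ?thesis using h src.base_card[OF B] by simp
  qed
qed

end

section \<open>Projective spaces\<close>

text \<open>The bound on \<open>n\<close> is what \<open>0 < k < n - 1\<close> implies; it keeps
  \<open>n - 1\<close> and \<open>n - 2\<close> free of truncation in the dual.\<close>

locale projective =
  fixes P :: "'a set" and L :: "'a set set" and n :: nat
  assumes proj: "proj_space_dim P L n" and dim: "3 \<le> n"
begin

sublocale lspace P L
  using proj unfolding proj_space_dim_def projective_space_def by unfold_locales simp

lemma plane_lines_meet:
  assumes "x \<in> P" "y \<in> P" "z \<in> P" "x \<noteq> y" "z \<notin> cl {x, y}"
    and "l \<in> L" "l' \<in> L" "l \<subseteq> cl {x, y, z}" "l' \<subseteq> cl {x, y, z}"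
  shows "l \<inter> l' \<noteq> {}"
  using has_dim_plane[OF assms(1-5)] assms(6-9) proj
  unfolding proj_space_dim_def projective_space_def by simp

lemma line_third_point:
  assumes xy: "x \<in> P" "y \<in> P" "x \<noteq> y"
  shows "\<exists>p\<in>cl {x, y}. p \<noteq> x \<and> p \<noteq> y"
proof -
  obtain l where l: "l \<in> L" "x \<in> l" "y \<in> l" using line_exists xy by blast
  have cl: "cl {x, y} = l" using span_pair[OF l xy(3)] .
  \<comment> \<open>Lines are proper subsets, so this one lies in a plane, where the axiom on three
    points applies.\<close>
  obtain z where z: "z \<in> P" "z \<notin> l" using line_subset[OF l(1)] by blast
  have "has_dim P L (cl {x, y, z}) 2" using has_dim_plane xy z cl by blast
  moreover have "l \<subseteq> cl {x, y, z}" using cl span_mono[of "{x, y}" "{x, y, z}" P L] by blast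
  ultimately have "\<exists>a b c. a \<in> l \<and> b \<in> l \<and> c \<in> l \<and> a \<noteq> b \<and> a \<noteq> c \<and> b \<noteq> c"
    using proj l(1) unfolding proj_space_dim_def projective_space_def by simp
  then show ?thesis unfolding cl by metis
qed

text \<open>The union \<open>?T\<close> of the lines from \<open>x\<close> to points of
  \<open>S\<close> is already a subspace. To see this, a point \<open>w\<close> on a line through
  \<open>y\<close> and \<open>z\<close> is projected from \<open>x\<close> onto the line through
  their feet \<open>h1\<close> and \<open>h2\<close> in \<open>S\<close>.\<close>

lemma join_point:
  assumes S: "subspace P L S" "S \<noteq> {}" and x: "x \<in> P" "x \<notin> S" and y: "y \<in> cl (insert x S)"
  shows "\<exists>h\<in>S. y \<in> cl {x, h}"
proof -
  let ?T = "\<Union>h\<in>S. cl {x, h}"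
  have SP: "S \<subseteq> P" using S unfolding subspace_def by blast
  have TP: "?T \<subseteq> P" using span_closed[of "{x, _}"] x SP by blast
  have "l \<subseteq> ?T" if l: "l \<in> L" "y \<in> ?T" "z \<in> ?T" "y \<noteq> z" "y \<in> l" "z \<in> l" for l y z
  proof
    fix w assume w: "w \<in> l"
    obtain h1 where h1: "h1 \<in> S" "y \<in> cl {x, h1}" using l by blast
    obtain h2 where h2: "h2 \<in> S" "z \<in> cl {x, h2}" using l by blast
    have ne: "x \<noteq> h1" "x \<noteq> h2" using x h1 h2 by auto
    have hP: "h1 \<in> P" "h2 \<in> P" using h1 h2 SP by auto
    obtain l1 where l1: "l1 \<in> L" "x \<in> l1" "h1 \<in> l1" using line_exists x hP ne by blast
    have c1: "cl {x, h1} = l1" using span_pair[OF l1 ne(1)] .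
    show "w \<in> ?T"
    proof (cases "h2 \<in> l1")
      case True
      then have "cl {x, h2} = l1" using span_pair[of l1 x h2] l1 ne by simp
      then have "l = l1" using line_unique[of l l1 y z] l l1 c1 h1 h2 by simp
      then show ?thesis using w c1 h1 by blast
    next
      case False
      then have n: "h2 \<notin> cl {x, h1}" using c1 by simp
      let ?E = "cl {x, h1, h2}"
      have E: "subspace P L ?E" using subspace_span[of "{x, h1, h2}"] x hP by simp
      have "y \<in> ?E" "z \<in> ?E"
        using h1(2) h2(2) span_mono[of "{x, h1}" "{x, h1, h2}" P L] span_mono[of "{x, h2}" "{x, h1, h2}" P L] by auto
      then have lE: "l \<subseteq> ?E" using subspace_line[OF E l(1)] l by blast
      show ?thesis
      proof (cases "w = x")
        case True
        then show ?thesis using h1 span_superset[of x "{x, h1}" P L] by blast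
      next
        case False
        have wP: "w \<in> P" using w line_subset[OF l(1)] by blast
        obtain k where k: "k \<in> L" "x \<in> k" "w \<in> k" using line_exists[of x w] x wP False by blast
        have "x \<in> ?E" using span_superset[of x "{x, h1, h2}" P L] by blast
        then have kE: "k \<subseteq> ?E" using subspace_line[OF E k(1), of x w] k lE w False by blast
        have h12: "h1 \<noteq> h2" using n span_superset[of h1 "{x, h1}" P L] by blast
        obtain k' where k': "k' \<in> L" "h1 \<in> k'" "h2 \<in> k'" using line_exists hP h12 by blast
        have "h1 \<in> ?E" "h2 \<in> ?E" using span_superset[of _ "{x, h1, h2}" P L] by auto
        then have k'E: "k' \<subseteq> ?E" using subspace_line[OF E k'(1)] k' h12 by blast
        \<comment> \<open>In the plane of \<open>x\<close>, \<open>h1\<close>, \<open>h2\<close> the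
          line through \<open>x\<close> and \<open>w\<close> meets the line through
          \<open>h1\<close> and \<open>h2\<close>; the meeting point is the foot of
          \<open>w\<close>.\<close>
        obtain h where h: "h \<in> k" "h \<in> k'"
          using plane_lines_meet[OF x(1) hP(1,2) ne(1) n k(1) k'(1) kE k'E] by blast
        have hS: "h \<in> S" using subspace_line[OF S(1) k'(1) h1(1) h2(1) h12 k'(2,3)] h by blast
        then have "cl {x, h} = k" using span_pair[of k x h] k h x by blast
        then show ?thesis using k hS by blast
      qed
    qed
  qed
  then have "subspace P L ?T" unfolding subspace_def using TP by simp
  moreover have "insert x S \<subseteq> ?T"
    using S(2) span_superset[of x "{x, _}" P L] span_superset[of _ "{x, _}" P L] by blast
  ultimately have "y \<in> ?T" using y subspace_span_mem by blast
  then show ?thesis by blast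
qed

text \<open>By \<open>join_point\<close>, \<open>y\<close> lies on a line from \<open>x\<close> to
  some \<open>h\<close> in the span of \<open>A\<close>, and then \<open>x\<close> lies on the line
  from \<open>y\<close> to \<open>h\<close>. A spanning set of least size serves as base.\<close>

sublocale exchange_space P L n
proof
  fix A x y
  assume A: "finite A" "A \<subseteq> P" and x: "x \<in> P" and y: "y \<in> cl (insert x A)" "y \<notin> cl A"
  show "x \<in> cl (insert y A)"
  proof (cases "A = {}")
    case True
    then show ?thesis using y x span_singleton[of x] by simp
  next
    case False
    have AS: "A \<subseteq> cl A" by (rule subset_span)
    have sub: "subspace P L (cl A)" using subspace_span[OF A(2)] .
    have xA: "x \<notin> cl A"
    proof
      assume "x \<in> cl A"
      then have "insert x A \<subseteq> cl A" using AS by blast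
      then show False using y span_trans by metis
    qed
    have "y \<in> cl (insert x (cl A))" using y(1) AS span_mono[of "insert x A" "insert x (cl A)" P L] by blast
    then obtain h where h: "h \<in> cl A" "y \<in> cl {x, h}" using join_point[OF sub _ x xA] False AS by blast
    have "h \<in> P" using h span_closed[OF A(2)] by blast
    then have "x \<in> cl {y, h}" using span_pair_exchange[OF x _ h(2)] h(1) y(2) xA by blast
    moreover have "{y, h} \<subseteq> cl (insert y A)"
      using h(1) span_mono[of A "insert y A" P L] span_superset[of y "insert y A" P L] by blast
    ultimately show ?thesis by (meson span_trans)
  qed
next
  obtain X where X: "X \<subseteq> P" "finite X" "card X = Suc n" "cl X = P"
    and min: "\<And>Y. Y \<subseteq> P \<Longrightarrow> finite Y \<Longrightarrow> cl Y = P \<Longrightarrow> Suc n \<le> card Y"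
    using proj unfolding proj_space_dim_def has_dim_def by auto
  have "x \<notin> cl (X - {x})" if x: "x \<in> X" for x
  proof
    assume "x \<in> cl (X - {x})"
    then have "X \<subseteq> cl (X - {x})" using subset_span[of "X - {x}" P L] by blast
    then have "cl (X - {x}) = P" using span_absorb[of X P L "X - {x}"] X by auto
    then have "Suc n \<le> card (X - {x})" using min[of "X - {x}"] X by blast
    then show False using X x by simp
  qed
  then show "\<exists>B\<subseteq>P. finite B \<and> card B = Suc n \<and> cl B = P \<and> (\<forall>x\<in>B. x \<notin> cl (B - {x}))"
    using X by (intro exI[of _ X]) simp
qed


section \<open>The dual space\<close>

abbreviation "Hyp \<equiv> dual_points P L n"
abbreviation "dcl \<equiv> span (dual_points P L n) (dual_lines P L n)"

section \<open>Hyperplanes and subspaces of codimension two\<close>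

lemma Hyp_iff: "H \<in> Hyp \<longleftrightarrow> (\<exists>I. indep I \<and> card I = n \<and> cl I = H)"
  unfolding dual_points_def Gr_def has_dim_iff using dim by simp

lemma Gr2_iff: "T \<in> Gr P L (n - 2) \<longleftrightarrow> (\<exists>I. indep I \<and> card I = n - 1 \<and> cl I = T)"
proof -
  have "Suc (n - 2) = n - 1" using dim by simp
  then show ?thesis unfolding Gr_def has_dim_iff by simp
qed

lemma base_hyperplane:
  assumes "base B" "b \<in> B"
  shows "cl (B - {b}) \<in> Hyp"
  unfolding Hyp_iff using assms base_card[OF assms(1)] baseD(1,3)[OF assms(1)] indep_subset[of B "B - {b}"]
  by (intro exI[of _ "B - {b}"]) auto

lemma Hyp_subspace:
  assumes "H \<in> Hyp"
  shows "subspace P L H" "H \<subseteq> P" "H \<noteq> {}" "H \<noteq> P"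
proof -
  obtain I where I: "indep I" "card I = n" "cl I = H" using assms Hyp_iff by blast
  then show "subspace P L H" using subspace_span[of I] unfolding indep_def by blast
  then show "H \<subseteq> P" unfolding subspace_def by blast
  have "I \<noteq> {}" using I dim by auto
  then show "H \<noteq> {}" using I subset_span[of I P L] by blast
  show "H \<noteq> P" using base_card[of I] I unfolding base_def by auto
qed

lemma Hyp_insert:
  assumes H: "H \<in> Hyp" and x: "x \<in> P" "x \<notin> H"
  shows "cl (insert x H) = P"
proof -
  obtain I where I: "indep I" "card I = n" "cl I = H" using H Hyp_iff by blast
  have "indep (insert x I)" using indep_insert[OF I(1)] x I(3) by blast
  moreover have "x \<notin> I" using x(2) I(3) span_superset[of x I P L] by blast
  then have "card (insert x I) = Suc n" using I unfolding indep_def by simp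
  ultimately have "cl (insert x I) = P" using indep_card_base baseD(4) by blast
  moreover have "insert x I \<subseteq> insert x H" using I(3) subset_span[of I P L] by blast
  ultimately have "P \<subseteq> cl (insert x H)" using span_mono[of "insert x I" "insert x H" P L] by simp
  then show ?thesis using span_closed[of "insert x H"] x(1) Hyp_subspace(2)[OF H] by blast
qed

lemma Hyp_eq:
  assumes "H \<in> Hyp" "H' \<in> Hyp" "H \<subseteq> H'"
  shows "H = H'"
proof (rule ccontr)
  assume "H \<noteq> H'"
  then obtain x where x: "x \<in> H'" "x \<notin> H" using assms by blast
  then have "cl (insert x H) = P" using Hyp_insert assms Hyp_subspace(2) by blast
  then have "P \<subseteq> H'" using span_least[OF Hyp_subspace(1)[OF assms(2)], of "insert x H"] x assms(3) by simp
  then show False using Hyp_subspace[OF assms(2)] by blast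
qed

text \<open>The line from \<open>x\<close> to another point of \<open>T\<close> meets
  \<open>H\<close>, and the meeting point stays in \<open>T\<close>; so \<open>T\<close> is the join
  of \<open>x\<close> and its section by \<open>H\<close>.\<close>

lemma Hyp_section:
  assumes T: "subspace P L T" and H: "H \<in> Hyp" and x: "x \<in> T" "x \<notin> H"
  shows "T \<subseteq> cl (insert x (T \<inter> H))"
proof
  fix y assume y: "y \<in> T"
  have P: "x \<in> P" "y \<in> P" using x y T unfolding subspace_def by auto
  show "y \<in> cl (insert x (T \<inter> H))"
  proof (cases "y \<in> insert x (T \<inter> H)")
    case True
    then show ?thesis by (rule span_superset)
  next
    case False
    obtain h where h: "h \<in> H" "y \<in> cl {x, h}"
      using join_point[OF Hyp_subspace(1,3)[OF H] P(1) x(2), of y] Hyp_insert[OF H P(1) x(2)] P(2) by blast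
    have hP: "h \<in> P" using h Hyp_subspace[OF H] by blast
    have "y \<noteq> x" "h \<noteq> x" using False h x by auto
    then have "h \<in> cl {y, x}" using span_pair_exchange[OF hP P(1), of y] h(2) insert_commute[of h x "{}"] by simp
    then have "h \<in> T" using subspace_span_mem[OF T, of "{y, x}"] x y by blast
    then have "{x, h} \<subseteq> insert x (T \<inter> H)" using h by blast
    then show ?thesis using h(2) span_mono[of "{x, h}" "insert x (T \<inter> H)" P L] by blast
  qed
qed

text \<open>Dual exchange, stated inside the space: a point \<open>y\<close> of
  \<open>T \<inter> H'\<close> outside \<open>H\<close> would generate \<open>T\<close> together
  with \<open>T \<inter> H\<close>, forcing \<open>T\<close> into \<open>H'\<close>.\<close>

lemma Hyp_cut:
  assumes "subspace P L T" "H \<in> Hyp" "H' \<in> Hyp" "T \<inter> H \<subseteq> H'" "\<not> T \<subseteq> H'"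
  shows "T \<inter> H' \<subseteq> H"
proof (rule subsetI, rule ccontr)
  fix y assume y: "y \<in> T \<inter> H'" "y \<notin> H"
  then have "T \<subseteq> cl (insert y (T \<inter> H))" using Hyp_section assms by blast
  also have "\<dots> \<subseteq> H'" using span_least[OF Hyp_subspace(1)[OF assms(3)], of "insert y (T \<inter> H)"] y assms(4) by simp
  finally show False using assms by blast
qed

text \<open>By \<open>Hyp_section\<close>, a base of the intersection becomes a base of
  \<open>H\<close> on adding one point of \<open>H\<close> outside \<open>H'\<close>.\<close>

lemma Hyp_Int:
  assumes H: "H \<in> Hyp" "H' \<in> Hyp" "H \<noteq> H'"
  shows "H \<inter> H' \<in> Gr P L (n - 2)"
proof -
  obtain x where x: "x \<in> H" "x \<notin> H'" using Hyp_eq[OF H(1,2)] H(3) by blast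
  obtain I where I: "indep I" "card I = n" "cl I = H" using H(1) Hyp_iff by blast
  have sub: "subspace P L (H \<inter> H')" using subspace_Int Hyp_subspace(1) H by blast
  obtain J where J: "J \<subseteq> H \<inter> H'" "indep J" "cl J = cl (H \<inter> H')"
    using indep_extend[OF indep_empty, of "H \<inter> H'"] Hyp_subspace(2)[OF H(1)] by auto
  have cJ: "cl J = H \<inter> H'" using J(3) span_subspace[OF sub] by simp
  have xP: "x \<in> P" using x Hyp_subspace(2)[OF H(1)] by blast
  have iJ: "indep (insert x J)" using indep_insert[OF J(2) xP] cJ x by blast
  have "insert x (H \<inter> H') \<subseteq> cl (insert x J)"
    using cJ span_mono[of J "insert x J" P L] span_superset[of x "insert x J" P L] by blast
  then have "H \<subseteq> cl (insert x J)"
    using Hyp_section[OF Hyp_subspace(1)[OF H(1)] H(2) x] span_subset_span[of "insert x (H \<inter> H')" P L "insert x J"] by blast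
  moreover have "cl (insert x J) \<subseteq> H"
    using span_least[OF Hyp_subspace(1)[OF H(1)], of "insert x J"] x J(1) by blast
  ultimately have "card (insert x J) = n" using indep_card_eq[OF iJ I(1)] I by simp
  moreover have "x \<notin> J" using x J by blast
  ultimately have "card J = n - 1" using J(2) unfolding indep_def by auto
  then show ?thesis using Gr2_iff J(2) cJ by blast
qed

lemma Gr2_eq:
  assumes "T \<in> Gr P L (n - 2)" "T' \<in> Gr P L (n - 2)" "T \<subseteq> T'"
  shows "T = T'"
proof -
  obtain I where I: "indep I" "card I = n - 1" "cl I = T" using assms Gr2_iff by blast
  obtain J where J: "indep J" "card J = n - 1" "cl J = T'" using assms Gr2_iff by blast
  have T'P: "T' \<subseteq> P" using J span_closed[of J] unfolding indep_def by blast
  have IT: "I \<subseteq> T'" using I(3) assms(3) subset_span[of I P L] by blast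
  obtain K where K: "I \<subseteq> K" "K \<subseteq> T'" "indep K" "cl K = cl T'" using indep_extend[OF I(1) IT T'P] by blast
  have cT': "cl T' = T'" using span_subspace subspace_span[of J] J unfolding indep_def by blast
  have "card K = card I" using indep_card_eq[OF K(3) J(1)] K(4) cT' J I by simp
  then have "I = K" using card_subset_eq[of K I] K unfolding indep_def by simp
  then show ?thesis using K cT' I by simp
qed

lemma Gr2_insert:
  assumes T: "T \<in> Gr P L (n - 2)" and x: "x \<in> P" "x \<notin> T"
  shows "cl (insert x T) \<in> Hyp"
proof -
  obtain I where I: "indep I" "card I = n - 1" "cl I = T" using T Gr2_iff by blast
  have "indep (insert x I)" using indep_insert[OF I(1)] x I(3) by blast
  moreover have "x \<notin> I" using x(2) I(3) span_superset[of x I P L] by blast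
  then have "card (insert x I) = n" using I dim unfolding indep_def by simp
  moreover have "cl (insert x T) = cl (insert x I)"
  proof (rule span_absorb)
    show "insert x T \<subseteq> cl (insert x I)"
      using I(3) span_mono[of I "insert x I" P L] span_superset[of x "insert x I" P L] by blast
    show "insert x I \<subseteq> insert x T" using I(3) subset_span[of I P L] by blast
  qed
  ultimately show ?thesis using Hyp_iff by metis
qed

lemma Gr2_line:
  assumes T: "T \<in> Gr P L (n - 2)"
  shows "{H \<in> Hyp. T \<subseteq> H} \<subset> Hyp" "\<exists>H H'. H \<noteq> H' \<and> H \<in> {H \<in> Hyp. T \<subseteq> H} \<and> H' \<in> {H \<in> Hyp. T \<subseteq> H}"
proof -
  obtain I where I: "indep I" "card I = n - 1" "cl I = T" using T Gr2_iff by blast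
  obtain B where B: "I \<subseteq> B" "base B" using base_extend[OF I(1)] by blast
  have "I \<noteq> {}" using I(2) dim by auto
  then obtain b where b: "b \<in> I" by blast
  have "cl (B - {b}) \<in> Hyp" using base_hyperplane B b by blast
  moreover have "\<not> T \<subseteq> cl (B - {b})"
    using base_span_mem[OF B(2), of "B - {b}" b] b B(1) I(3) span_superset[of b I P L] by blast
  ultimately show "{H \<in> Hyp. T \<subseteq> H} \<subset> Hyp" by blast
  have TP: "T \<subseteq> P" using I span_closed[of I] unfolding indep_def by blast
  have "T \<noteq> P" using base_card[of I] I unfolding base_def by auto
  then obtain x where x: "x \<in> P" "x \<notin> T" using TP by blast
  have H1: "cl (insert x T) \<in> Hyp" by (rule Gr2_insert[OF T x])
  have s: "T \<subseteq> cl (insert z T)" for z using subset_span[of "insert z T" P L] by blast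
  obtain y where y: "y \<in> P" "y \<notin> cl (insert x T)" using Hyp_subspace[OF H1] by blast
  then have yT: "y \<notin> T" using s by blast
  have H2: "cl (insert y T) \<in> Hyp" by (rule Gr2_insert[OF T y(1) yT])
  have "cl (insert x T) \<noteq> cl (insert y T)" using y span_superset[of y "insert y T" P L] by blast
  then show "\<exists>H H'. H \<noteq> H' \<and> H \<in> {H \<in> Hyp. T \<subseteq> H} \<and> H' \<in> {H \<in> Hyp. T \<subseteq> H}"
    using H1 H2 s by blast
qed

section \<open>Lines and spans in the dual\<close>

lemma dual_linear: "linear_space Hyp (dual_lines P L n)"
  unfolding linear_space_def
proof (intro conjI ballI impI)
  have line: "\<exists>T\<in>Gr P L (n - 2). l = {H \<in> Hyp. T \<subseteq> H}" if "l \<in> dual_lines P L n" for l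
    using that unfolding dual_lines_def dual_points_def by auto
  fix l assume "l \<in> dual_lines P L n"
  then obtain T where T: "T \<in> Gr P L (n - 2)" "l = {H \<in> Hyp. T \<subseteq> H}" using line by blast
  show "l \<subset> Hyp" using Gr2_line(1)[OF T(1)] T(2) by simp
  show "\<exists>p q. p \<noteq> q \<and> p \<in> l \<and> q \<in> l" using Gr2_line(2)[OF T(1)] unfolding T(2) .
next
  fix H H' assume H: "H \<in> Hyp" "H' \<in> Hyp" "H \<noteq> H'"
  have G: "H \<inter> H' \<in> Gr P L (n - 2)" using Hyp_Int[OF H] .
  show "\<exists>!l. l \<in> dual_lines P L n \<and> H \<in> l \<and> H' \<in> l"
  proof (rule ex1I[of _ "{K \<in> Hyp. H \<inter> H' \<subseteq> K}"])
    show "{K \<in> Hyp. H \<inter> H' \<subseteq> K} \<in> dual_lines P L n \<and> H \<in> {K \<in> Hyp. H \<inter> H' \<subseteq> K} \<and> H' \<in> {K \<in> Hyp. H \<inter> H' \<subseteq> K}"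
      using G H unfolding dual_lines_def dual_points_def by auto
    fix l assume l: "l \<in> dual_lines P L n \<and> H \<in> l \<and> H' \<in> l"
    then obtain T where T: "T \<in> Gr P L (n - 2)" "l = {K \<in> Hyp. T \<subseteq> K}"
      unfolding dual_lines_def dual_points_def by auto
    then have "T \<subseteq> H \<inter> H'" using l by auto
    then show "l = {K \<in> Hyp. H \<inter> H' \<subseteq> K}" using Gr2_eq[OF T(1) G] T(2) by simp
  qed
qed

sublocale dual_lspace: lspace Hyp "dual_lines P L n"
  using dual_linear by unfold_locales

lemma dual_subspace: "subspace Hyp (dual_lines P L n) {H \<in> Hyp. M \<subseteq> H}"
proof -
  have "l \<subseteq> {H \<in> Hyp. M \<subseteq> H}"
    if l: "l \<in> dual_lines P L n" "H \<in> {H \<in> Hyp. M \<subseteq> H}" "H' \<in> {H \<in> Hyp. M \<subseteq> H}" "H \<noteq> H'" "H \<in> l" "H' \<in> l" for l H H'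
  proof -
    obtain T where T: "T \<in> Gr P L (n - 2)" "l = {K \<in> Hyp. T \<subseteq> K}"
      using l(1) unfolding dual_lines_def dual_points_def by auto
    have "T = H \<inter> H'" using Gr2_eq[OF T(1) Hyp_Int] T(2) l by auto
    then show ?thesis using T(2) l by auto
  qed
  then show ?thesis unfolding subspace_def by simp
qed

text \<open>Intersecting with \<open>P\<close> makes the empty family yield the whole space instead
  of the universe of the type.\<close>

lemma subspace_Inter_Hyp: "X \<subseteq> Hyp \<Longrightarrow> subspace P L (P \<inter> \<Inter>X)"
proof -
  assume X: "X \<subseteq> Hyp"
  have "l \<subseteq> P \<inter> \<Inter>X" if l: "l \<in> L" "p \<in> P \<inter> \<Inter>X" "q \<in> P \<inter> \<Inter>X" "p \<noteq> q" "p \<in> l" "q \<in> l" for l p q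
  proof -
    have "l \<subseteq> H" if "H \<in> X" for H using subspace_line[of H l p q] Hyp_subspace(1)[of H] X that l by blast
    then show ?thesis using line_subset[OF l(1)] by blast
  qed
  then show ?thesis unfolding subspace_def by simp
qed

text \<open>By induction: a hyperplane \<open>H\<close> through the smaller intersection lies in a
  pencil with the new \<open>K\<close> and some \<open>H2\<close> that contains the larger
  intersection \<open>?T\<close>, and \<open>H2\<close> is in the span by the induction
  hypothesis.\<close>

lemma dual_span:
  assumes "finite X" "X \<subseteq> Hyp"
  shows "dcl X = {H \<in> Hyp. P \<inter> \<Inter>X \<subseteq> H}"
proof
  show "dcl X \<subseteq> {H \<in> Hyp. P \<inter> \<Inter>X \<subseteq> H}"
    by (rule span_least[OF dual_subspace]) (use assms in auto)
  show "{H \<in> Hyp. P \<inter> \<Inter>X \<subseteq> H} \<subseteq> dcl X"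
    using assms
  proof (induction X rule: finite_induct)
    case empty
    \<comment> \<open>No hyperplane contains all of \<open>P\<close>.\<close>
    then show ?case using Hyp_subspace(2,4) by blast
  next
    case (insert K X)
    let ?T = "P \<inter> \<Inter>X"
    have T: "subspace P L ?T" using subspace_Inter_Hyp insert by blast
    have K: "K \<in> Hyp" using insert by blast
    have IH: "{H \<in> Hyp. ?T \<subseteq> H} \<subseteq> dcl (insert K X)"
      using insert span_mono[of X "insert K X" Hyp "dual_lines P L n"] by blast
    have KX: "K \<in> dcl (insert K X)" using span_superset[of K "insert K X"] by blast
    show ?case
    proof
      fix H assume H: "H \<in> {H \<in> Hyp. P \<inter> \<Inter>(insert K X) \<subseteq> H}"
      then have TK: "H \<in> Hyp" "?T \<inter> K \<subseteq> H" by auto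
      show "H \<in> dcl (insert K X)"
      proof (cases "?T \<subseteq> H \<or> H = K")
        case True
        then show ?thesis using IH TK KX by blast
      next
        case False
        then obtain x where x: "x \<in> ?T" "x \<notin> H" by blast
        then have xK: "x \<notin> K" using TK by blast
        have cut: "?T \<inter> H \<subseteq> K" using Hyp_cut[OF T K TK(1) TK(2)] False by blast
        have HK: "H \<inter> K \<in> Gr P L (n - 2)" using Hyp_Int TK(1) K False by blast
        \<comment> \<open>The member through \<open>x\<close> of the pencil of \<open>H\<close> and
          \<open>K\<close>. It contains \<open>?T\<close>, which is spanned by \<open>x\<close> and
          its section by \<open>H\<close>, and that section lies in \<open>K\<close>.\<close>
        define H2 where "H2 = cl (insert x (H \<inter> K))"
        have H2: "H2 \<in> Hyp" unfolding H2_def using Gr2_insert[OF HK] x by blast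
        have "insert x (?T \<inter> H) \<subseteq> insert x (H \<inter> K)" using cut by blast
        then have "?T \<subseteq> H2" unfolding H2_def
          using Hyp_section[OF T TK(1) x] span_mono[of "insert x (?T \<inter> H)" "insert x (H \<inter> K)" P L] by blast
        then have H2X: "H2 \<in> dcl (insert K X)" using IH H2 by blast
        have ins: "insert x (H \<inter> K) \<subseteq> H2" unfolding H2_def by (rule subset_span)
        then have ne: "H2 \<noteq> K" using xK by blast
        have line: "{M \<in> Hyp. H \<inter> K \<subseteq> M} \<in> dual_lines P L n"
          using HK unfolding dual_lines_def dual_points_def by auto
        have "{M \<in> Hyp. H \<inter> K \<subseteq> M} \<subseteq> dcl (insert K X)"
        proof (rule dual_lspace.subspace_line[OF dual_lspace.subspace_span line H2X KX ne])
          show "insert K X \<subseteq> Hyp" using insert.prems .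
        qed (use H2 K ins in auto)
        then show ?thesis using TK(1) by blast
      qed
    qed
  qed
qed

text \<open>A point in all these hyperplanes has a support that avoids every element of
  \<open>Y\<close>.\<close>

lemma base_Inter_span:
  assumes B: "base B" and Y: "Y \<subseteq> B"
  shows "P \<inter> \<Inter>((\<lambda>b. cl (B - {b})) ` Y) = cl (B - Y)"
proof
  show "cl (B - Y) \<subseteq> P \<inter> \<Inter>((\<lambda>b. cl (B - {b})) ` Y)"
  proof -
    have "cl (B - Y) \<subseteq> cl (B - {b})" if "b \<in> Y" for b using that by (intro span_mono) blast
    moreover have "cl (B - Y) \<subseteq> P" using span_closed[of "B - Y"] baseD(2)[OF B] by blast
    ultimately show ?thesis by blast
  qed
  show "P \<inter> \<Inter>((\<lambda>b. cl (B - {b})) ` Y) \<subseteq> cl (B - Y)"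
  proof
    fix z assume z: "z \<in> P \<inter> \<Inter>((\<lambda>b. cl (B - {b})) ` Y)"
    then obtain C where C: "C \<subseteq> B" "\<forall>X\<subseteq>B. z \<in> cl X \<longleftrightarrow> C \<subseteq> X" using base_support[OF B, of z] by blast
    have "C \<subseteq> B - {b}" if "b \<in> Y" for b
    proof -
      have "z \<in> cl (B - {b})" using z that by blast
      then show ?thesis using C(2) by blast
    qed
    then have "C \<subseteq> B - Y" using C(1) by blast
    then show "z \<in> cl (B - Y)" using C(2) by blast
  qed
qed

lemma dual_base_span:
  assumes B: "base B" and Y: "Y \<subseteq> B"
  shows "dcl ((\<lambda>b. cl (B - {b})) ` Y) = {H \<in> Hyp. cl (B - Y) \<subseteq> H}"
proof -
  have "finite Y" using Y baseD(1)[OF B] finite_subset by blast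
  moreover have "(\<lambda>b. cl (B - {b})) ` Y \<subseteq> Hyp" using base_hyperplane[OF B] Y by blast
  ultimately show ?thesis using dual_span[of "(\<lambda>b. cl (B - {b})) ` Y"] base_Inter_span[OF B Y] by simp
qed

lemma hyperplane_inj:
  assumes B: "base B"
  shows "inj_on (\<lambda>b. cl (B - {b})) B"
proof (rule inj_onI)
  fix b c assume h: "b \<in> B" "c \<in> B" "cl (B - {b}) = cl (B - {c})"
  then have "B - {b} = B - {c}" using base_span_inj[OF B, of "B - {b}" "B - {c}"] by blast
  then show "b = c" using h by blast
qed

text \<open>\<open>D\<close> consists of the faces of the simplex \<open>B\<close>. All faces but
  the one opposite \<open>b\<close> pass through \<open>b\<close>, so that one is not in their
  span.\<close>

lemma dual_base_properties:
  assumes B: "base B"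
  defines "D \<equiv> (\<lambda>b. cl (B - {b})) ` B"
  shows "D \<subseteq> Hyp" "finite D" "card D = Suc n" "dcl D = Hyp" "\<forall>K\<in>D. K \<notin> dcl (D - {K})"
proof -
  show "D \<subseteq> Hyp" unfolding D_def using base_hyperplane[OF B] by blast
  show "finite D" unfolding D_def using baseD(1)[OF B] by blast
  show "card D = Suc n" unfolding D_def using card_image[OF hyperplane_inj[OF B]] base_card[OF B] by simp
  show "dcl D = Hyp" unfolding D_def using dual_base_span[OF B subset_refl] span_empty by simp
  show "\<forall>K\<in>D. K \<notin> dcl (D - {K})"
  proof
    fix K assume "K \<in> D"
    then obtain b where b: "b \<in> B" "K = cl (B - {b})" unfolding D_def by blast
    have "D - {K} = (\<lambda>b. cl (B - {b})) ` (B - {b})"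
      unfolding D_def using b inj_on_image_set_diff[OF hyperplane_inj[OF B], of B "{b}"] by simp
    then have "dcl (D - {K}) = {H \<in> Hyp. cl (B - (B - {b})) \<subseteq> H}"
      using dual_base_span[OF B, of "B - {b}"] by simp
    moreover have "b \<in> cl (B - (B - {b}))" using b by (intro span_superset) blast
    moreover have "b \<notin> K" using base_span_mem[OF B, of "B - {b}" b] b by blast
    ultimately show "K \<notin> dcl (D - {K})" by blast
  qed
qed

text \<open>Once spans are computed by \<open>dual_span\<close>, exchange becomes
  \<open>Hyp_cut\<close> for the intersection \<open>?M\<close> of \<open>A\<close>.\<close>

sublocale dual: exchange_space Hyp "dual_lines P L n" n
proof
  fix A H K
  assume A: "finite A" "A \<subseteq> Hyp" and H: "H \<in> Hyp" and K: "K \<in> dcl (insert H A)" "K \<notin> dcl A"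
  let ?M = "P \<inter> \<Inter>A"
  have M: "subspace P L ?M" using subspace_Inter_Hyp A by blast
  have KH: "K \<in> Hyp" "?M \<inter> H \<subseteq> K" using K(1) dual_span[of "insert H A"] A H by auto
  have "\<not> ?M \<subseteq> K" using K(2) KH(1) dual_span[OF A] by blast
  then have "?M \<inter> K \<subseteq> H" using Hyp_cut[OF M H KH] by blast
  then show "H \<in> dcl (insert K A)" using dual_span[of "insert K A"] A H KH by auto
next
  obtain B where "base B" using base_extend[OF indep_empty] by blast
  from dual_base_properties[OF this]
  show "\<exists>B\<subseteq>Hyp. finite B \<and> card B = Suc n \<and> dcl B = Hyp \<and> (\<forall>x\<in>B. x \<notin> dcl (B - {x}))" by blast
qed

lemma dual_base:
  assumes "base B"
  shows "dual.base ((\<lambda>b. cl (B - {b})) ` B)"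
  unfolding dual.base_def dual.indep_def using dual_base_properties[OF assms] by simp

end

text \<open>The hyperplanes through \<open>f S\<close> form the subspace of the dual identified with
  \<open>f S\<close>, so the last equation expresses \<open>f = G_k(g)\<close> under the
  identification.\<close>

theorem theorem2p2:
  fixes P :: "'a set" and L :: "'a set set" and P' :: "'b set" and L' :: "'b set set"
    and n k :: nat and f :: "'a set \<Rightarrow> 'b set"
  assumes "proj_space_dim P L n" and "proj_space_dim P' L' n"
    and "0 < k" and "k < n - 1"
    and "\<forall>S\<in>Gr P L k. f S \<in> Gr P' L' k"
    and "\<forall>\<B>. is_base_subset P L k \<B> \<longrightarrow> is_base_subset P' L' k (f ` \<B>)"
  shows "(n \<noteq> 2 * k + 1 \<longrightarrow>
            (\<exists>g. strong_embedding P L P' L' g \<and> (\<forall>S\<in>Gr P L k. f S = span P' L' (g ` S))))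
       \<and> (n = 2 * k + 1 \<longrightarrow>
            (\<exists>g. strong_embedding P L P' L' g \<and> (\<forall>S\<in>Gr P L k. f S = span P' L' (g ` S)))
          \<or> (\<exists>g. strong_embedding P L (dual_points P' L' n) (dual_lines P' L' n) g \<and>
               (\<forall>S\<in>Gr P L k. span (dual_points P' L' n) (dual_lines P' L' n) (g ` S)
                              = {H \<in> dual_points P' L' n. f S \<subseteq> H})))"
proof -
  have n: "3 \<le> n" using assms(3,4) by linarith
  interpret src: projective P L n using assms(1) n by unfold_locales
  interpret tgt: projective P' L' n using assms(2) n by unfold_locales
  interpret base_subset_map P L P' L' n "Suc k" f
  proof
    show "2 \<le> Suc k" "Suc k + 2 \<le> Suc n" using assms(3,4) by auto
    show "\<exists>p\<in>src.cl {x, y}. p \<noteq> x \<and> p \<noteq> y" if "x \<in> P" "y \<in> P" "x \<noteq> y" for x y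
      using src.line_third_point that .
    show "\<exists>B'. tgt.base B' \<and> f ` src.subsets_span (Suc k) B = tgt.subsets_span (Suc k) B'"
      if B: "src.base B" for B
    proof -
      have "is_base_subset P L k (src.subsets_span (Suc k) B)"
        unfolding is_base_subset_def using B src.is_base_iff src.base_subset_of_eq[OF B, of k] by metis
      then have "is_base_subset P' L' k (f ` src.subsets_span (Suc k) B)" using assms(6) by simp
      then obtain B' where "is_base P' L' B'" "f ` src.subsets_span (Suc k) B = base_subset_of P' L' k B'"
        unfolding is_base_subset_def by blast
      then show ?thesis using tgt.is_base_iff tgt.base_subset_of_eq[of B' k] by metis
    qed
  qed
  have direct_case: "\<exists>g. strong_embedding P L P' L' g \<and> (\<forall>S\<in>Gr P L k. f S = span P' L' (g ` S))"
    if "\<And>B. src.base B \<Longrightarrow> direct B"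
    using strong_embedding_of_direct[OF that refl] .
  have dual_case: "\<exists>g. strong_embedding P L (dual_points P' L' n) (dual_lines P' L' n) g \<and>
               (\<forall>S\<in>Gr P L k. span (dual_points P' L' n) (dual_lines P' L' n) (g ` S)
                              = {H \<in> dual_points P' L' n. f S \<subseteq> H})"
    if opp: "\<And>B. src.base B \<Longrightarrow> opposite B"
  proof -
    \<comment> \<open>\<open>f\<close> followed by passage to the dual; the gluing argument is run
      again for this map.\<close>
    let ?F = "\<lambda>S. {H \<in> dual_points P' L' n. f S \<subseteq> H}"
    interpret D: space_pair P L "dual_points P' L' n" "dual_lines P' L' n" n "Suc k" ?F
      using m by unfold_locales
    have "D.direct B" if B: "src.base B" for B
    proof -
      obtain \<tau> where \<tau>: "inj_on \<tau> B" "tgt.base (\<tau> ` B)"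
        "\<forall>X. X \<subseteq> B \<longrightarrow> card X = Suc k \<longrightarrow> f (src.cl X) = tgt.cl (\<tau> ` B - \<tau> ` X)"
        using opp[OF B] unfolding opposite_def by blast
      \<comment> \<open>The face opposite \<open>b\<close> in the image base. Faces indexed by the
        image of \<open>X\<close> span exactly the hyperplanes through the complementary points,
        which cancels the complement in \<open>opposite\<close>.\<close>
      let ?h = "\<lambda>b. tgt.cl (\<tau> ` B - {b})"
      have "inj_on (?h \<circ> \<tau>) B" using comp_inj_on[OF \<tau>(1) tgt.hyperplane_inj[OF \<tau>(2)]] .
      moreover have "tgt.dual.base ((?h \<circ> \<tau>) ` B)" using tgt.dual_base[OF \<tau>(2)] by (simp add: image_comp)
      moreover have "?F (src.cl X) = tgt.dcl ((?h \<circ> \<tau>) ` X)" if X: "X \<subseteq> B" "card X = Suc k" for X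
      proof -
        have "tgt.dcl (?h ` (\<tau> ` X)) = {H \<in> dual_points P' L' n. tgt.cl (\<tau> ` B - \<tau> ` X) \<subseteq> H}"
          by (rule tgt.dual_base_span[OF \<tau>(2) image_mono[OF X(1)]])
        then show ?thesis using \<tau>(3) X by (simp add: image_comp)
      qed
      ultimately show ?thesis unfolding D.direct_def by (intro exI[of _ "?h \<circ> \<tau>"]) simp
    qed
    then obtain g where "strong_embedding P L (dual_points P' L' n) (dual_lines P' L' n) g"
      "\<forall>S\<in>Gr P L k. ?F S = tgt.dcl (g ` S)"
      using D.strong_embedding_of_direct[OF _ refl] by auto
    then show ?thesis by (intro exI[of _ g]) simp
  qed
  show ?thesis
  proof (intro conjI impI)
    assume "n \<noteq> 2 * k + 1"
    \<comment> \<open>With \<open>m = Suc k\<close> the condition \<open>Suc n = 2 * m\<close>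
      attached to the opposite type reads \<open>n = 2 * k + 1\<close>.\<close>
    then show "\<exists>g. strong_embedding P L P' L' g \<and> (\<forall>S\<in>Gr P L k. f S = span P' L' (g ` S))"
      using direct_or_opposite direct_case by simp
  next
    have "(\<forall>B. src.base B \<longrightarrow> direct B) \<or> (\<forall>B. src.base B \<longrightarrow> opposite B)"
      using type_constant direct_or_opposite by blast
    then show "(\<exists>g. strong_embedding P L P' L' g \<and> (\<forall>S\<in>Gr P L k. f S = span P' L' (g ` S)))
          \<or> (\<exists>g. strong_embedding P L (dual_points P' L' n) (dual_lines P' L' n) g \<and>
               (\<forall>S\<in>Gr P L k. span (dual_points P' L' n) (dual_lines P' L' n) (g ` S)
                              = {H \<in> dual_points P' L' n. f S \<subseteq> H}))"
      using direct_case dual_case by blast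
  qed
qed

end
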